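(* Let $n\ge2$, let $q=p^m$ with $p$ prime and $m\ge1$, let $T$ be a basis of $\mathbb{F}_q$ over $\mathbb{F}_p$, and let $U:=UT(n,\mathbb{F}_q)$ be the group of upper unitriangular $n\times n$ matrices over $\mathbb{F}_q$. Let $I=\{1,\dots,n-1\}$ and let $\Gamma:=(U,(U_i)_{i\in I})$ be the coset incidence system with $U_i:=\langle e_j(t)\mid t\in T,\ j\in I\setminus\{i\}\rangle$. Then: (1) $U$ acts flag-transitively on $\Gamma$; (2) $\Gamma$ is residually connected; (3) $\Gamma$ is thick for $q\ne2$, and $\Gamma$ is thin for $q=2$; (4) $\Gamma$ has linear Buekenhout diagram: every vertex $i\in I$ has order $o_i=q-1$; vertices $i,j$ with $|i-j|>1$ are not joined by an edge; and for $1\le i\le n-2$ the vertices $i$ and $i+1$ are joined by an edge whose label $(d_{i,i+1},g_{i,i+1},d_{i+1,i})$ is $(4,3,4)$ when $q\neq2$, and $(4,4,4)$ (i.e. the corresponding residues are generalized $4$-gons) when $q=2$.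
   Context: For $1\le i\le n-1$ and $t\in\mathbb{F}_q$, $e_i(t)=e_{i,i+1}(t)$ is the unitriangular matrix with $(i,i+1)$-entry $t$ and all other off-diagonal entries $0$. Incidence geometry. An incidence system over a type set $I$ consists of a set $X$ of elements, a type map $X\to I$, and a symmetric reflexive incidence relation such that distinct incident elements have different types. Its incidence graph has vertex set $X$, with distinct incident elements joined by an edge. A flag is a set of pairwise incident elements; its type is the set of types of its elements; a chamber is a flag of type $I$. It is an incidence geometry if all maximal flags are chambers. The residue $\Gamma_F$ of a flag $F$ is the incidence system of all elements not in $F$ incident to every element of $F$; it has type $I\setminus t(F)$ and rank $|I|-|F|$, where $t(F)$ is the type of $F$. A geometry is residually connected if all its residues (including that of the empty flag) of rank at least two have connected incidence graph. It is firm, thin, thick if every residue of a flag of rank $|I|-1$ contains at least two, exactly two, more than two elements, respectively. Coset incidence system. $(G,(G_i)_{i\in I})$ has as elements of type $i$ the left cosets $gG_i$ (elements of different types regarded as distinct), with $gG_i$ incident to $kG_j$ iff $gG_i\cap kG_j\neq\emptyset$. $G$ acts by left multiplication; it acts flag-transitively if for each $J\subseteq I$ it is transitive on flags of type $J$. Buekenhout diagram (of a firm, residually connected, flag-transitive geometry over $I$). The vertex set is $I$. To each vertex $i$ attach the order $o_i=|\Gamma_F|-1$, with $F$ a flag of type $I\setminus\{i\}$. Distinct $i,j$ are not joined if the residues of type $\{i,j\}$ are generalized digons (every $i$-element is incident to every $j$-element). Otherwise they are joined by an edge labelled $(d_{ij},g_{ij},d_{ji})$, where for a residue $\Gamma_F$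 of type $\{i,j\}$: $g_{ij}$ (gonality) is half the girth of the incidence graph of $\Gamma_F$, and $d_{ij}$ (resp. $d_{ji}$) is the greatest distance in that graph from an $i$-element (resp. $j$-element) to any other element. If $g_{ij}=d_{ij}=d_{ji}=k$ the residue is called a generalized $k$-gon. *)

theory Defs
  imports
    "Graph_Theory.Pair_Digraph"
    "Graph_Theory.Digraph_Component"
    "Graph_Theory.Vertex_Walk"
    "HOL-Library.Extended_Nat"
    "HOL-Algebra.Generated_Groups"
    "Jordan_Normal_Form.Matrix"
    "Berlekamp_Zassenhaus.Finite_Field"
begin

section \<open>Incidence geometry\<close>

record ('x, 'i) incidence_structure =
  Elems :: "'x set"
  Types :: "'i set"
  type_of :: "'x \<Rightarrow> 'i"
  incident :: "'x \<Rightarrow> 'x \<Rightarrow> bool"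

text \<open>Type sets are taken to be finite, so that ranks are natural numbers given by \<^const>\<open>card\<close>.\<close>

definition incidence_system :: "('x, 'i) incidence_structure \<Rightarrow> bool" where
  "incidence_system \<Gamma> \<longleftrightarrow>
     finite (Types \<Gamma>) \<and>
     type_of \<Gamma> ` Elems \<Gamma> \<subseteq> Types \<Gamma> \<and>
     (\<forall>x\<in>Elems \<Gamma>. incident \<Gamma> x x) \<and>
     (\<forall>x\<in>Elems \<Gamma>. \<forall>y\<in>Elems \<Gamma>. incident \<Gamma> x y \<longrightarrow> incident \<Gamma> y x) \<and>
     (\<forall>x\<in>Elems \<Gamma>. \<forall>y\<in>Elems \<Gamma>. incident \<Gamma> x y \<and> x \<noteq> y \<longrightarrow> type_of \<Gamma> x \<noteq> type_of \<Gamma> y)"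

definition flag :: "('x, 'i) incidence_structure \<Rightarrow> 'x set \<Rightarrow> bool" where
  "flag \<Gamma> F \<longleftrightarrow> F \<subseteq> Elems \<Gamma> \<and> (\<forall>x\<in>F. \<forall>y\<in>F. incident \<Gamma> x y)"

definition flag_of_type :: "('x, 'i) incidence_structure \<Rightarrow> 'i set \<Rightarrow> 'x set \<Rightarrow> bool" where
  "flag_of_type \<Gamma> J F \<longleftrightarrow> flag \<Gamma> F \<and> type_of \<Gamma> ` F = J"

definition chamber :: "('x, 'i) incidence_structure \<Rightarrow> 'x set \<Rightarrow> bool" where
  "chamber \<Gamma> F \<longleftrightarrow> flag_of_type \<Gamma> (Types \<Gamma>) F"

definition incidence_geometry :: "('x, 'i) incidence_structure \<Rightarrow> bool" where
  "incidence_geometry \<Gamma> \<longleftrightarrow> incidence_system \<Gamma> \<and>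
     (\<forall>F. flag \<Gamma> F \<and> (\<forall>F'. flag \<Gamma> F' \<and> F \<subseteq> F' \<longrightarrow> F' = F) \<longrightarrow> chamber \<Gamma> F)"

definition residue ::
  "('x, 'i) incidence_structure \<Rightarrow> 'x set \<Rightarrow> ('x, 'i) incidence_structure" where
  "residue \<Gamma> F = \<lparr>
     Elems = {x \<in> Elems \<Gamma> - F. \<forall>y\<in>F. incident \<Gamma> x y},
     Types = Types \<Gamma> - type_of \<Gamma> ` F,
     type_of = type_of \<Gamma>,
     incident = incident \<Gamma>\<rparr>"

definition rank :: "('x, 'i) incidence_structure \<Rightarrow> nat" where
  "rank \<Gamma> = card (Types \<Gamma>)"

text \<open>Undirected graphs are represented as symmetric digraphs without loops.\<close>

definition incidence_graph :: "('x, 'i) incidence_structure \<Rightarrow> 'x pair_pre_digraph" where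
  "incidence_graph \<Gamma> = \<lparr>
     pverts = Elems \<Gamma>,
     parcs = {(x, y). x \<in> Elems \<Gamma> \<and> y \<in> Elems \<Gamma> \<and> x \<noteq> y \<and> incident \<Gamma> x y}\<rparr>"

definition residually_connected :: "('x, 'i) incidence_structure \<Rightarrow> bool" where
  "residually_connected \<Gamma> \<longleftrightarrow>
     (\<forall>F. flag \<Gamma> F \<and> rank (residue \<Gamma> F) \<ge> 2 \<longrightarrow>
        connected (with_proj (incidence_graph (residue \<Gamma> F))))"

definition thin :: "('x, 'i) incidence_structure \<Rightarrow> bool" where
  "thin \<Gamma> \<longleftrightarrow>
     (\<forall>F. flag \<Gamma> F \<and> rank (residue \<Gamma> F) = 1 \<longrightarrow> card (Elems (residue \<Gamma> F)) = 2)"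

definition thick :: "('x, 'i) incidence_structure \<Rightarrow> bool" where
  "thick \<Gamma> \<longleftrightarrow>
     (\<forall>F. flag \<Gamma> F \<and> rank (residue \<Gamma> F) = 1 \<longrightarrow>
        infinite (Elems (residue \<Gamma> F)) \<or> card (Elems (residue \<Gamma> F)) > 2)"

text \<open>\<open>act\<close> is the action of the group \<open>G\<close> on the elements of \<open>\<Gamma>\<close>.\<close>

definition flag_transitive ::
  "('g, 'm) monoid_scheme \<Rightarrow> ('g \<Rightarrow> 'x \<Rightarrow> 'x) \<Rightarrow> ('x, 'i) incidence_structure \<Rightarrow> bool" where
  "flag_transitive G act \<Gamma> \<longleftrightarrow>
     (\<forall>J \<subseteq> Types \<Gamma>. \<forall>F F'. flag_of_type \<Gamma> J F \<and> flag_of_type \<Gamma> J F' \<longrightarrow>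
        (\<exists>g\<in>carrier G. act g ` F = F'))"


section \<open>Coset incidence systems\<close>

text \<open>An element of type \<open>i\<close> is a coset tagged with \<open>i\<close>, so that elements of different types
  are distinct even if they are equal as sets.\<close>

definition coset_incidence_system ::
  "('g, 'm) monoid_scheme \<Rightarrow> 'i set \<Rightarrow> ('i \<Rightarrow> 'g set) \<Rightarrow> ('i \<times> 'g set, 'i) incidence_structure"
  where
  "coset_incidence_system G I H = \<lparr>
     Elems = {(i, g <#\<^bsub>G\<^esub> H i) | i g. i \<in> I \<and> g \<in> carrier G},
     Types = I,
     type_of = fst,
     incident = (\<lambda>x y. snd x \<inter> snd y \<noteq> {})\<rparr>"

definition coset_action ::
  "('g, 'm) monoid_scheme \<Rightarrow> 'g \<Rightarrow> 'i \<times> 'g set \<Rightarrow> 'i \<times> 'g set" where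
  "coset_action G g x = (fst x, g <#\<^bsub>G\<^esub> snd x)"


section \<open>Distance and girth\<close>

text \<open>The distance is infinite if there is no walk, the girth is infinite if there is no cycle.\<close>

definition graph_dist :: "('v, 'e) pre_digraph \<Rightarrow> 'v \<Rightarrow> 'v \<Rightarrow> enat" where
  "graph_dist G u v = (INF p \<in> {p. vwalk p G \<and> hd p = u \<and> last p = v}. enat (vwalk_length p))"

text \<open>A cycle is given by the list of its vertices, the first vertex not being repeated at the end;
  hence its length is the length of the list. Requiring at least three vertices excludes
  traversing an undirected edge back and forth.\<close>

definition graph_cycle :: "('v, 'e) pre_digraph \<Rightarrow> 'v list \<Rightarrow> bool" where
  "graph_cycle G p \<longleftrightarrow> vpath p G \<and> length p \<ge> 3 \<and> (last p, hd p) \<in> arcs_ends G"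

definition girth :: "('v, 'e) pre_digraph \<Rightarrow> enat" where
  "girth G = (INF p \<in> {p. graph_cycle G p}. enat (length p))"


section \<open>Buekenhout diagrams\<close>

definition max_dist_from :: "('x, 'i) incidence_structure \<Rightarrow> 'i \<Rightarrow> enat" where
  "max_dist_from R i =
     (SUP x \<in> {x \<in> Elems R. type_of R x = i}. SUP y \<in> Elems R - {x}.
        graph_dist (with_proj (incidence_graph R)) x y)"

definition generalized_digon :: "('x, 'i) incidence_structure \<Rightarrow> 'i \<Rightarrow> 'i \<Rightarrow> bool" where
  "generalized_digon R i j \<longleftrightarrow>
     (\<forall>x\<in>Elems R. \<forall>y\<in>Elems R. type_of R x = i \<and> type_of R y = j \<longrightarrow> incident R x y)"

text \<open>For a rank two residue \<open>R\<close> of type \<open>{i, j}\<close>, the triple is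
  (\<open>i\<close>-diameter, gonality, \<open>j\<close>-diameter); the gonality is half the girth.\<close>

definition rank2_parameters ::
  "('x, 'i) incidence_structure \<Rightarrow> 'i \<Rightarrow> 'i \<Rightarrow> enat \<times> enat \<times> enat \<Rightarrow> bool" where
  "rank2_parameters R i j = (\<lambda>(d, g, d').
     max_dist_from R i = d \<and>
     girth (with_proj (incidence_graph R)) = 2 * g \<and>
     max_dist_from R j = d')"

definition generalized_polygon ::
  "('x, 'i) incidence_structure \<Rightarrow> 'i \<Rightarrow> 'i \<Rightarrow> enat \<Rightarrow> bool" where
  "generalized_polygon R i j k \<longleftrightarrow> rank2_parameters R i j (k, k, k)"

text \<open>The diagram is only meaningful for firm, residually connected, flag-transitive geometries, where all residues of a given
  type are isomorphic. The order and the label are required to be the stated ones for every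
  residue of the relevant type.\<close>

definition vertex_order :: "('x, 'i) incidence_structure \<Rightarrow> 'i \<Rightarrow> nat \<Rightarrow> bool" where
  "vertex_order \<Gamma> i k \<longleftrightarrow>
     (\<forall>F. flag_of_type \<Gamma> (Types \<Gamma> - {i}) F \<longrightarrow> card (Elems (residue \<Gamma> F)) = k + 1)"

definition joined :: "('x, 'i) incidence_structure \<Rightarrow> 'i \<Rightarrow> 'i \<Rightarrow> bool" where
  "joined \<Gamma> i j \<longleftrightarrow> i \<noteq> j \<and>
     \<not> (\<forall>F. flag_of_type \<Gamma> (Types \<Gamma> - {i, j}) F \<longrightarrow> generalized_digon (residue \<Gamma> F) i j)"

definition edge_label ::
  "('x, 'i) incidence_structure \<Rightarrow> 'i \<Rightarrow> 'i \<Rightarrow> enat \<times> enat \<times> enat \<Rightarrow> bool" where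
  "edge_label \<Gamma> i j l \<longleftrightarrow>
     (\<forall>F. flag_of_type \<Gamma> (Types \<Gamma> - {i, j}) F \<longrightarrow> rank2_parameters (residue \<Gamma> F) i j l)"


section \<open>Unitriangular groups\<close>

definition UT :: "nat \<Rightarrow> 'a::field mat monoid" where
  "UT n = \<lparr>
     carrier = {A \<in> carrier_mat n n. upper_triangular A \<and> (\<forall>i<n. A $$ (i, i) = 1)},
     mult = (*),
     one = 1\<^sub>m n\<rparr>"

text \<open>Matrix indices start at 0, whereas \<open>j \<in> {1..n-1}\<close>: the 1-based position \<open>(j, j + 1)\<close>
  is \<open>(j - 1, j)\<close> here.\<close>

definition e_mat :: "nat \<Rightarrow> nat \<Rightarrow> 'a::field \<Rightarrow> 'a mat" where
  "e_mat n j t = mat n n (\<lambda>(r, c). if r = c then 1 else if r + 1 = j \<and> c = j then t else 0)"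


section \<open>Bases over the prime field\<close>

text \<open>The prime field with \<open>p\<close> elements is \<open>'p mod_ring\<close>, where \<open>CARD('p) = p\<close>.
  It acts on a field of characteristic \<open>p\<close> through integer representatives.\<close>

definition Fp_scale :: "'p::prime_card mod_ring \<Rightarrow> 'a::field \<Rightarrow> 'a" where
  "Fp_scale c x = of_int (to_int_mod_ring c) * x"

definition Fp_basis :: "'p::prime_card itself \<Rightarrow> 'a::field set \<Rightarrow> bool" where
  "Fp_basis _ T \<longleftrightarrow>
     \<not> module.dependent (Fp_scale :: 'p mod_ring \<Rightarrow> 'a \<Rightarrow> 'a) T \<and>
     module.span (Fp_scale :: 'p mod_ring \<Rightarrow> 'a \<Rightarrow> 'a) T = UNIV"

lemma vector_space_Fp_scale:
  assumes "CHAR('a::field) = CARD('p::prime_card)"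
  shows "vector_space (Fp_scale :: 'p mod_ring \<Rightarrow> 'a \<Rightarrow> 'a)"
proof -
  have red: "(of_int (k mod int CARD('p)) :: 'a) = of_int k" for k
    using assms by (simp add: of_int_eq_iff_cong_CHAR cong_def)
  show ?thesis
    by standard
      (auto simp: Fp_scale_def to_int_mod_ring_add to_int_mod_ring_mult red algebra_simps)
qed

end

theory Submission
  imports Defs "Jordan_Normal_Form.Gauss_Jordan_Elimination"
begin

text \<open>
  The subgroup \<open>U\<^sub>i\<close> consists of the block diagonal matrices \<open>diag(A, B)\<close> with unitriangular blocks,
  \<open>A\<close> of size \<open>i\<close>. Geometrically it is the stabiliser in \<open>U\<close> of the complement
  \<open>W\<^sub>i = \<langle>v\<^sub>i\<^sub>+\<^sub>1, ..., v\<^sub>n\<rangle>\<close> of \<open>\<langle>v\<^sub>1, ..., v\<^sub>i\<rangle>\<close>, where \<open>v\<^sub>1, ..., v\<^sub>n\<close> is the standard basis; an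
  element of type \<open>i\<close> is such a complement, and incidence is inclusion. Hence flags are chains, and
  incidence is transitive along increasing types. In the language of groups, both facts come from
  the factorisation \<open>diag(A, B) = diag(1, B) diag(A, 1)\<close>: the first factor lies in \<open>U\<^sub>i\<close> for all
  \<open>i \<le> j\<close>, the second in \<open>U\<^sub>k\<close> for all \<open>k \<ge> j\<close>, if \<open>diag(A, B) \<in> U\<^sub>j\<close>. This is all that is needed
  to show that the members of a flag have a common element
  (\<open>linear_coset_geometry.common_element\<close>). So every flag of type \<open>J\<close> is a translate of the standard
  one, which makes \<open>\<Gamma>\<close> a flag-transitive geometry, and the elements of its residue are the cosets
  \<open>g d U\<^sub>i\<close> with \<open>d\<close> in \<open>U\<^sub>J\<close>, the intersection of the \<open>U\<^sub>j\<close> with \<open>j \<in> J\<close>.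

  The group \<open>U\<^sub>J\<close> consists of the unitriangular matrices that are block diagonal with breaks at all
  \<open>j \<in> J\<close>. Clearing the last row that is not yet trivial, and writing elementary matrices as
  commutators, shows that \<open>U\<^sub>J\<close> is generated by the root groups \<open>{e\<^sub>k(t)}\<close> with \<open>k \<notin> J\<close>
  (\<open>block_unitri_subset_subgroup\<close>). For \<open>J = {i}\<close> this identifies the groups of the theorem; here the
  basis \<open>T\<close> suffices since \<open>t \<mapsto> e\<^sub>k(t)\<close> is additive. For arbitrary \<open>J\<close> it says that \<open>U\<^sub>J\<close> is
  generated by the root groups it contains for the simple roots, which yields residual connectedness. A residue of rank
  one is in bijection with a root group, so the order is \<open>q - 1\<close>.

  If some \<open>k\<close> lies strictly between \<open>i\<close> and \<open>j\<close>, then in a residue of type \<open>{i, j}\<close> all elements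
  of type \<open>i\<close> and \<open>j\<close> are incident to the same element of type \<open>k\<close>, hence to each other. For
  adjacent types \<open>i\<close> and \<open>i + 1\<close> the group \<open>U\<^sub>J\<close> is a Heisenberg group with entries \<open>a, b, c\<close>. Its
  cosets of the two root groups are described by the pairs \<open>(a, c - a b)\<close> and \<open>(b, c)\<close>, so that the
  residue is the affine plane over the field without its vertical lines: the point \<open>(a, u)\<close> lies on
  the line \<open>(b, c)\<close> if \<open>c = u + a b\<close> (\<open>affine_net_residue\<close>). Two points of a column and two parallel
  lines have distance \<open>4\<close>, and no distance is larger. There is a triangle without a vertical side
  once there are three columns, so the girth is \<open>6\<close>; for \<open>q = 2\<close> the graph is an octagon.
\<close>

no_notation subset_mset (infix "<#" 50)

section \<open>Coset geometries of linear type\<close>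

text \<open>
  The relation in the assumption admits loops, which the incidence graph does not; this spares a
  distinctness proof whenever a path is built from possibly equal elements.
\<close>
lemma connected_incidence_graphI:
  fixes R :: "('x, 'y) incidence_structure"
  assumes ne: "Elems R \<noteq> {}"
    and conn: "\<And>x y. x \<in> Elems R \<Longrightarrow> y \<in> Elems R \<Longrightarrow>
       (x, y) \<in> {(x, y). x \<in> Elems R \<and> y \<in> Elems R \<and> incident R x y}\<^sup>*"
  shows "connected (with_proj (incidence_graph R))"
proof -
  let ?E = "{(x, y). x \<in> Elems R \<and> y \<in> Elems R \<and> incident R x y}"
  have "(x, y) \<in> rtrancl_on (Elems R) ((parcs (incidence_graph R))\<^sup>s)"
    if "x \<in> Elems R" "(x, y) \<in> ?E\<^sup>*" for x y
    using that(2,1)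
  proof (induction rule: rtrancl_induct)
    case base
    then show ?case by (rule rtrancl_on_refl)
  next
    case (step y z)
    show ?case
    proof (cases "y = z")
      case True
      then show ?thesis using step by simp
    next
      case False
      then have "(y, z) \<in> (parcs (incidence_graph R))\<^sup>s"
        using step.hyps by (auto simp: symcl_def incidence_graph_def)
      then show ?thesis
        using step by (intro rtrancl_on_into_rtrancl_on[OF step.IH]) auto
    qed
  qed
  then show ?thesis
    using ne conn by (simp add: connected_conv incidence_graph_def)
qed

text \<open>
  Linearity of the diagram is captured by \<open>split\<close>: the stabiliser \<open>H j\<close> of the standard element of
  type \<open>j\<close> is the product of the stabiliser of all standard elements of types up to \<open>j\<close> and of that
  of all standard elements of types from \<open>j\<close> on. Connectedness of the residues is captured by
  \<open>generated\<close>: the stabiliser of a standard flag is generated by the stabilisers of the standard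
  flags of corank one above it.
\<close>
locale linear_coset_geometry = group G for G :: "('g, 'm) monoid_scheme" (structure) +
  fixes I :: "'i::linorder set" and H :: "'i \<Rightarrow> 'g set"
  assumes finite_I: "finite I"
    and subgroup_H: "i \<in> I \<Longrightarrow> subgroup (H i) G"
    and split: "\<lbrakk>j \<in> I; x \<in> H j\<rbrakk> \<Longrightarrow>
       \<exists>a b. x = a \<otimes> b \<and> (\<forall>i\<in>I. i \<le> j \<longrightarrow> a \<in> H i) \<and> (\<forall>k\<in>I. j \<le> k \<longrightarrow> b \<in> H k)"
    and generated: "J \<subseteq> I \<Longrightarrow> carrier G \<inter> (\<Inter>j\<in>J. H j) \<subseteq>
       generate G (\<Union>i\<in>I - J. carrier G \<inter> (\<Inter>j\<in>I - {i}. H j))"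
begin

definition stab :: "'i set \<Rightarrow> 'g set" where
  "stab J = carrier G \<inter> (\<Inter>j\<in>J. H j)"

abbreviation \<Gamma> :: "('i \<times> 'g set, 'i) incidence_structure" where
  "\<Gamma> \<equiv> coset_incidence_system G I H"

definition std_flag :: "'g \<Rightarrow> 'i set \<Rightarrow> ('i \<times> 'g set) set" where
  "std_flag g J = (\<lambda>j. (j, g <# H j)) ` J"

lemma stab_carrier: "x \<in> stab J \<Longrightarrow> x \<in> carrier G"
  by (simp add: stab_def)

lemma H_carrier: "i \<in> I \<Longrightarrow> x \<in> H i \<Longrightarrow> x \<in> carrier G"
  using subgroup_H subgroup.mem_carrier by metis

lemma mem_coset_iff:
  assumes "i \<in> I" "g \<in> carrier G"
  shows "x \<in> g <# H i \<longleftrightarrow> x \<in> carrier G \<and> inv g \<otimes> x \<in> H i"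
proof
  assume "x \<in> g <# H i"
  then obtain h where "h \<in> H i" "x = g \<otimes> h" by (auto simp: l_coset_def)
  then show "x \<in> carrier G \<and> inv g \<otimes> x \<in> H i"
    using assms H_carrier by (simp add: m_assoc[symmetric])
next
  assume x: "x \<in> carrier G \<and> inv g \<otimes> x \<in> H i"
  then have "x = g \<otimes> (inv g \<otimes> x)" using assms by (simp add: m_assoc[symmetric])
  with x show "x \<in> g <# H i" by (auto simp: l_coset_def)
qed

lemma coset_eq:
  assumes "i \<in> I" "g \<in> carrier G" "x \<in> g <# H i"
  shows "g <# H i = x <# H i"
  using l_repr_independence[OF assms(3,2) subgroup_H[OF assms(1)]] .

lemma rep_in_coset: "i \<in> I \<Longrightarrow> g \<in> carrier G \<Longrightarrow> g \<in> g <# H i"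
  by (simp add: mem_coset_iff subgroup.one_closed[OF subgroup_H])

lemma mult_in_coset: "i \<in> I \<Longrightarrow> g \<in> carrier G \<Longrightarrow> h \<in> H i \<Longrightarrow> g \<otimes> h \<in> g <# H i"
  by (auto simp: l_coset_def)

lemma coset_eq_iff:
  assumes "i \<in> I" "g \<in> carrier G" "h \<in> carrier G"
  shows "g <# H i = h <# H i \<longleftrightarrow> inv g \<otimes> h \<in> H i"
  using assms coset_eq mem_coset_iff rep_in_coset by metis

lemma Gamma_simps [simp]:
  "Types \<Gamma> = I" "type_of \<Gamma> = fst" "incident \<Gamma> x y \<longleftrightarrow> snd x \<inter> snd y \<noteq> {}"
  by (simp_all add: coset_incidence_system_def)

lemma Elems_Gamma: "Elems \<Gamma> = {(i, g <# H i) | i g. i \<in> I \<and> g \<in> carrier G}"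
  by (simp add: coset_incidence_system_def)

lemma ElemsD:
  assumes "x \<in> Elems \<Gamma>" "g \<in> snd x"
  shows "fst x \<in> I" "g \<in> carrier G" "x = (fst x, g <# H (fst x))"
proof -
  obtain i h where x: "x = (i, h <# H i)" "i \<in> I" "h \<in> carrier G"
    using assms(1) by (auto simp: Elems_Gamma)
  then show "fst x \<in> I" "g \<in> carrier G" using assms(2) by (auto simp: mem_coset_iff)
  show "x = (fst x, g <# H (fst x))" using x assms(2) coset_eq by auto
qed

lemma same_type_incident_eq:
  assumes "x \<in> Elems \<Gamma>" "y \<in> Elems \<Gamma>" "incident \<Gamma> x y" "fst x = fst y"
  shows "x = y"
  using assms ElemsD(3)[of x] ElemsD(3)[of y] by fastforce

lemma incident_refl: "x \<in> Elems \<Gamma> \<Longrightarrow> incident \<Gamma> x x"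
  using rep_in_coset unfolding Elems_Gamma Gamma_simps by fastforce

lemma incidence_system: "incidence_system \<Gamma>"
  unfolding incidence_system_def
proof (intro conjI ballI impI)
  show "incident \<Gamma> y x" if "incident \<Gamma> x y" for x y using that by auto
  show "type_of \<Gamma> x \<noteq> type_of \<Gamma> y"
    if "x \<in> Elems \<Gamma>" "y \<in> Elems \<Gamma>" "incident \<Gamma> x y \<and> x \<noteq> y" for x y
    using same_type_incident_eq that by (metis Gamma_simps(2))
qed (use finite_I incident_refl in \<open>auto simp: Elems_Gamma\<close>)

text \<open>
  By induction on the largest type \<open>m\<close>. Let \<open>g\<close> lie in all cosets of smaller type, the largest of these being \<open>j\<close>, and let \<open>y\<close>
  lie in the cosets of types \<open>j\<close> and \<open>m\<close>. Then \<open>y = g a b\<close> with \<open>a b \<in> H j\<close> split as in the axiom.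
  The correction \<open>g a\<close> stays in the cosets of types up to \<open>j\<close> because of \<open>a\<close>, and differs from \<open>y\<close>
  by \<open>b\<close>, which is absorbed by the coset of type \<open>m\<close>.
\<close>
lemma common_element:
  assumes "finite K" "K \<subseteq> I" "\<And>k. k \<in> K \<Longrightarrow> x k \<in> carrier G"
    and "\<And>i j. i \<in> K \<Longrightarrow> j \<in> K \<Longrightarrow> (x i <# H i) \<inter> (x j <# H j) \<noteq> {}"
  shows "\<exists>g\<in>carrier G. \<forall>k\<in>K. g \<in> x k <# H k"
  using assms
proof (induction K rule: finite_linorder_max_induct)
  case empty
  then show ?case by auto
next
  case (insert m A)
  then obtain g where g: "g \<in> carrier G" "\<And>k. k \<in> A \<Longrightarrow> g \<in> x k <# H k" by auto
  have mI: "m \<in> I" "x m \<in> carrier G" using insert.prems by auto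
  show ?case
  proof (cases "A = {}")
    case True
    then show ?thesis using mI rep_in_coset by auto
  next
    case False
    define j where "j = Max A"
    have j: "j \<in> A" "\<And>k. k \<in> A \<Longrightarrow> k \<le> j" "j < m" "j \<in> I"
    proof -
      show "j \<in> A" using False insert.hyps(1) by (simp add: j_def)
      then show "j < m" "j \<in> I" using insert.hyps(2) insert.prems(1) by auto
      show "k \<le> j" if "k \<in> A" for k using that insert.hyps(1) by (simp add: j_def)
    qed
    obtain y where y: "y \<in> x j <# H j" "y \<in> x m <# H m"
      using insert.prems(3)[of j m] j by auto
    have "y \<in> g <# H j" using y g j coset_eq insert.prems by blast
    then obtain h where h: "h \<in> H j" "y = g \<otimes> h" by (auto simp: l_coset_def)
    from split[OF \<open>j \<in> I\<close> h(1)] obtain a b where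
      ab: "h = a \<otimes> b" "\<And>i. i \<in> I \<Longrightarrow> i \<le> j \<Longrightarrow> a \<in> H i" "\<And>k. k \<in> I \<Longrightarrow> j \<le> k \<Longrightarrow> b \<in> H k"
      by auto
    have c: "a \<in> carrier G" "b \<in> carrier G" "b \<in> H m"
      using ab(2,3) j(3,4) H_carrier[OF \<open>j \<in> I\<close>] mI by (auto intro: less_imp_le)
    have "g \<otimes> a \<in> x k <# H k" if "k \<in> A" for k
    proof -
      have "k \<in> I" "x k \<in> carrier G" "k \<le> j" using that insert.prems j by auto
      then show ?thesis using coset_eq[OF _ _ g(2)[OF that]] mult_in_coset g(1) ab(2) by auto
    qed
    moreover have "g \<otimes> a \<in> x m <# H m"
    proof -
      have "x m <# H m = y <# H m" using coset_eq mI y by blast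
      moreover have "g \<otimes> a = y \<otimes> inv b" using g c h ab by (simp add: m_assoc)
      moreover have "y \<in> carrier G" using g c h ab by simp
      ultimately show ?thesis
        using mult_in_coset[OF mI(1), of y "inv b"] c(3) subgroup.m_inv_closed[OF subgroup_H[OF mI(1)]]
        by simp
    qed
    ultimately show ?thesis using g c by auto
  qed
qed

lemma std_flag_type: "fst ` std_flag g J = J"
  by (force simp: std_flag_def image_image)

lemma std_flag_flag:
  assumes "g \<in> carrier G" "J \<subseteq> I"
  shows "flag \<Gamma> (std_flag g J)"
proof -
  have "g \<in> snd x" if "x \<in> std_flag g J" for x
    using that assms rep_in_coset by (auto simp: std_flag_def)
  moreover have "std_flag g J \<subseteq> Elems \<Gamma>" using assms by (auto simp: std_flag_def Elems_Gamma)
  ultimately show ?thesis unfolding flag_def Gamma_simps by blast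
qed

text \<open>This makes \<open>G\<close> transitive on the flags of each type.\<close>
lemma flag_std:
  assumes "flag \<Gamma> F"
  obtains g where "g \<in> carrier G" "F = std_flag g (fst ` F)" "fst ` F \<subseteq> I"
proof -
  have el: "F \<subseteq> Elems \<Gamma>" and inc: "\<And>x y. x \<in> F \<Longrightarrow> y \<in> F \<Longrightarrow> snd x \<inter> snd y \<noteq> {}"
    using assms by (auto simp: flag_def)
  have sub: "fst ` F \<subseteq> I" using el by (auto simp: Elems_Gamma)
  have "\<forall>k\<in>fst ` F. \<exists>h\<in>carrier G. (k, h <# H k) \<in> F"
    using el by (fastforce simp: Elems_Gamma)
  then obtain x where x: "\<And>k. k \<in> fst ` F \<Longrightarrow> x k \<in> carrier G \<and> (k, x k <# H k) \<in> F"
    by metis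
  have "\<exists>g\<in>carrier G. \<forall>k\<in>fst ` F. g \<in> x k <# H k"
  proof (rule common_element)
    show "finite (fst ` F)" using sub finite_I finite_subset by blast
    show "(x i <# H i) \<inter> (x j <# H j) \<noteq> {}" if "i \<in> fst ` F" "j \<in> fst ` F" for i j
      using inc[of "(i, x i <# H i)" "(j, x j <# H j)"] x[OF that(1)] x[OF that(2)] by simp
  qed (use sub x in auto)
  then obtain g where g: "g \<in> carrier G" "\<And>k. k \<in> fst ` F \<Longrightarrow> g \<in> x k <# H k" by auto
  have eq: "y = (fst y, g <# H (fst y))" if "y \<in> F" for y
  proof -
    have k: "fst y \<in> fst ` F" using that by simp
    have "y = (fst y, x (fst y) <# H (fst y))"
      using same_type_incident_eq[of y "(fst y, x (fst y) <# H (fst y))"] el that x[OF k] inc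
      unfolding Gamma_simps fst_conv by blast
    moreover have "x (fst y) <# H (fst y) = g <# H (fst y)"
      using coset_eq g(2)[OF k] x[OF k] sub k by blast
    ultimately show ?thesis by simp
  qed
  have "F = std_flag g (fst ` F)"
    unfolding std_flag_def image_image using eq by force
  with that g sub show ?thesis by blast
qed

theorem incidence_geometry: "incidence_geometry \<Gamma>"
  unfolding incidence_geometry_def
proof (intro conjI allI impI incidence_system)
  fix F assume F: "flag \<Gamma> F \<and> (\<forall>F'. flag \<Gamma> F' \<and> F \<subseteq> F' \<longrightarrow> F' = F)"
  then obtain g where g: "g \<in> carrier G" "F = std_flag g (fst ` F)" "fst ` F \<subseteq> I"
    using flag_std by blast
  have "F \<subseteq> std_flag g I" using g(2,3) unfolding std_flag_def by blast
  then have "std_flag g I = F" using F std_flag_flag g(1) by blast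
  then show "chamber \<Gamma> F"
    using F std_flag_type by (auto simp: chamber_def flag_of_type_def)
qed

theorem flag_transitive: "flag_transitive G (coset_action G) \<Gamma>"
  unfolding flag_transitive_def
proof (intro allI impI)
  fix J F F' assume "J \<subseteq> Types \<Gamma>" and F: "flag_of_type \<Gamma> J F \<and> flag_of_type \<Gamma> J F'"
  obtain g where g: "g \<in> carrier G" "F = std_flag g J" "J \<subseteq> I"
    using F flag_std by (metis flag_of_type_def Gamma_simps(2))
  obtain g' where g': "g' \<in> carrier G" "F' = std_flag g' J"
    using F flag_std by (metis flag_of_type_def Gamma_simps(2))
  have "(g' \<otimes> inv g) <# (g <# H j) = g' <# H j" if "j \<in> J" for j
    using g g' that lcos_m_assoc[of "H j" "g' \<otimes> inv g" g] subgroup.subset[OF subgroup_H[of j]]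
    by (auto simp: m_assoc)
  then have "coset_action G (g' \<otimes> inv g) ` F = F'"
    by (auto simp: g g' std_flag_def coset_action_def image_image)
  then show "\<exists>g\<in>carrier G. coset_action G g ` F = F'" using g g' by blast
qed

lemma residue_simps [simp]:
  "Types (residue \<Gamma> F) = I - fst ` F" "type_of (residue \<Gamma> F) = fst"
  "incident (residue \<Gamma> F) x y \<longleftrightarrow> snd x \<inter> snd y \<noteq> {}"
  by (simp_all add: residue_def)

text \<open>
  An element of the residue forms a flag together with the given one. A common element \<open>h\<close> of this
  larger flag differs from \<open>g\<close> by an element of the stabiliser.
\<close>
lemma Elems_residue:
  assumes g: "g \<in> carrier G" and J: "J \<subseteq> I"
  shows "Elems (residue \<Gamma> (std_flag g J)) = {(i, (g \<otimes> d) <# H i) | i d. i \<in> I - J \<and> d \<in> stab J}"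
    (is "?E = ?S")
proof
  show "?S \<subseteq> ?E"
  proof clarify
    fix i d assume i: "i \<in> I" "i \<notin> J" and d: "d \<in> stab J"
    have gd: "g \<otimes> d \<in> carrier G" using g d by (simp add: stab_def)
    have "g \<otimes> d \<in> g <# H j" if "j \<in> J" for j
      using that d g J by (auto simp: stab_def intro: mult_in_coset)
    then show "(i, (g \<otimes> d) <# H i) \<in> ?E"
      using i gd rep_in_coset[OF i(1) gd] by (auto simp: residue_def Elems_Gamma std_flag_def)
  qed
  show "?E \<subseteq> ?S"
  proof
    fix x assume x: "x \<in> ?E"
    let ?F = "std_flag g J"
    have F: "flag \<Gamma> ?F" using std_flag_flag g J .
    have el: "x \<in> Elems \<Gamma>" "x \<notin> ?F" and inc: "\<And>y. y \<in> ?F \<Longrightarrow> incident \<Gamma> x y"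
      using x by (auto simp: residue_def)
    have "flag \<Gamma> (insert x ?F)"
      using F el inc incident_refl by (auto simp: flag_def Int_commute)
    then obtain h where h: "h \<in> carrier G" "insert x ?F = std_flag h (fst ` insert x ?F)"
      by (rule flag_std)
    have hx: "y = (fst y, h <# H (fst y))" if "y \<in> insert x ?F" for y
    proof -
      have "y \<in> std_flag h (fst ` insert x ?F)" using h(2) that by blast
      then show ?thesis by (auto simp: std_flag_def)
    qed
    have xI: "fst x \<in> I" using el by (auto simp: Elems_Gamma)
    have nJ: "fst x \<notin> J"
    proof
      assume "fst x \<in> J"
      then have y: "(fst x, g <# H (fst x)) \<in> ?F" by (simp add: std_flag_def)
      with F have "(fst x, g <# H (fst x)) \<in> Elems \<Gamma>" by (auto simp: flag_def)
      with same_type_incident_eq[OF el(1) this inc[OF y]] y el(2) show False by simp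
    qed
    have d: "inv g \<otimes> h \<in> stab J"
    proof -
      have "inv g \<otimes> h \<in> H j" if "j \<in> J" for j
      proof -
        have "g <# H j = h <# H j" using hx[of "(j, g <# H j)"] that by (auto simp: std_flag_def)
        then show ?thesis using coset_eq_iff that J g h by blast
      qed
      then show ?thesis using g h by (auto simp: stab_def)
    qed
    have "x = (fst x, (g \<otimes> (inv g \<otimes> h)) <# H (fst x))"
      using hx[of x] g h by (simp add: m_assoc[symmetric])
    then show "x \<in> ?S" using d xI nJ by blast
  qed
qed

lemma subgroup_stab: "J \<subseteq> I \<Longrightarrow> subgroup (stab J) G"
proof (rule subgroupI)
  assume J: "J \<subseteq> I"
  then have sub: "subgroup (H j) G" if "j \<in> J" for j using that subgroup_H by blast
  show "stab J \<subseteq> carrier G" by (simp add: stab_def)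
  have "\<one> \<in> stab J" using sub subgroup.one_closed by (auto simp: stab_def)
  then show "stab J \<noteq> {}" by blast
  show "inv a \<in> stab J" if "a \<in> stab J" for a
    using that sub subgroup.m_inv_closed by (fastforce simp: stab_def)
  show "a \<otimes> b \<in> stab J" if "a \<in> stab J" "b \<in> stab J" for a b
    using that sub subgroup.m_closed by (fastforce simp: stab_def)
qed

text \<open>
  Multiplying \<open>d\<close> by a generator \<open>s\<close> of corank one, of type \<open>k\<close> say, fixes all cosets of types
  \<open>l \<noteq> k\<close>. Since the rank is at least two, some such \<open>l\<close> is available in the residue, and the
  elements of any type \<open>i\<close> given by \<open>d\<close> and \<open>d s\<close> are joined through the one of type \<open>l\<close>.
\<close>
theorem residually_connected: "residually_connected \<Gamma>"
  unfolding residually_connected_def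
proof (intro allI impI)
  fix F assume F: "flag \<Gamma> F \<and> 2 \<le> rank (residue \<Gamma> F)"
  then obtain g where g: "g \<in> carrier G" "F = std_flag g (fst ` F)" "fst ` F \<subseteq> I"
    using flag_std by blast
  define J where "J = fst ` F"
  have FJ: "F = std_flag g J" "J \<subseteq> I" using g by (auto simp: J_def)
  have rk: "2 \<le> card (I - J)" using F by (simp add: rank_def J_def)
  let ?R = "residue \<Gamma> F"
  have El: "Elems ?R = {(i, (g \<otimes> d) <# H i) | i d. i \<in> I - J \<and> d \<in> stab J}"
    using Elems_residue[OF g(1) FJ(2)] FJ(1) by simp
  let ?E = "{(x, y). x \<in> Elems ?R \<and> y \<in> Elems ?R \<and> incident ?R x y}"
  have gc: "g \<otimes> d \<in> carrier G" if "d \<in> stab J" for d using that g by (simp add: stab_def)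
  have adj: "((i, (g \<otimes> d) <# H i), (l, (g \<otimes> d) <# H l)) \<in> ?E"
    if "i \<in> I - J" "l \<in> I - J" "d \<in> stab J" for i l d
    using that rep_in_coset[of _ "g \<otimes> d"] gc unfolding El by fastforce
  have genJ: "stab J \<subseteq> generate G (\<Union>i\<in>I - J. stab (I - {i}))"
    using generated[OF FJ(2)] by (simp add: stab_def)
  have step: "((i, (g \<otimes> d) <# H i), (i, (g \<otimes> (d \<otimes> s)) <# H i)) \<in> ?E\<^sup>* \<and> s \<in> stab J"
    if k: "k \<in> I - J" "s \<in> stab (I - {k})" and d: "d \<in> stab J" and i: "i \<in> I - J" for d s i k
  proof
    obtain l where l: "l \<in> I - J" "l \<noteq> k"
    proof -
      have "\<not> I - J \<subseteq> {k}"
        using rk card_mono[of "{k}" "I - J"] by auto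
      then show ?thesis using that by blast
    qed
    have "J \<subseteq> I - {k}" using k FJ by auto
    then show sJ: "s \<in> stab J" using k by (auto simp: stab_def)
    have ds: "d \<otimes> s \<in> stab J"
      using sJ d subgroup.m_closed[OF subgroup_stab[OF FJ(2)]] by blast
    have as: "g \<otimes> d \<otimes> s = g \<otimes> (d \<otimes> s)"
      using g d sJ by (simp add: stab_def m_assoc)
    have lI: "l \<in> I" and "s \<in> H l" using k l by (auto simp: stab_def)
    from mult_in_coset[OF lI gc[OF d] this(2)]
    have "(g \<otimes> d) <# H l = (g \<otimes> (d \<otimes> s)) <# H l"
      unfolding as by (rule coset_eq[OF lI gc[OF d]])
    with adj[OF i l(1) d] adj[OF l(1) i ds]
    show "((i, (g \<otimes> d) <# H i), (i, (g \<otimes> (d \<otimes> s)) <# H i)) \<in> ?E\<^sup>*"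
      by (metis (no_types, lifting) r_into_rtrancl rtrancl_trans)
  qed
  have gen: "s \<in> stab J \<and>
      (\<forall>d\<in>stab J. \<forall>i\<in>I - J. ((i, (g \<otimes> d) <# H i), (i, (g \<otimes> (d \<otimes> s)) <# H i)) \<in> ?E\<^sup>*)"
    if "s \<in> generate G (\<Union>i\<in>I - J. stab (I - {i}))" for s
    using that
  proof (induction rule: generate.induct)
    case one
    then show ?case using subgroup.one_closed[OF subgroup_stab[OF FJ(2)]] by (simp add: stab_def)
  next
    case (incl s)
    then show ?case using step subgroup.one_closed[OF subgroup_stab[OF FJ(2)]] by blast
  next
    case (inv s)
    then obtain k where k: "k \<in> I - J" "s \<in> stab (I - {k})" by blast
    then have "inv s \<in> stab (I - {k})"
      using subgroup.m_inv_closed[OF subgroup_stab] by blast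
    then show ?case using step k(1) subgroup.one_closed[OF subgroup_stab[OF FJ(2)]] by blast
  next
    case (eng s t)
    show ?case
    proof (intro conjI ballI)
      show "s \<otimes> t \<in> stab J"
        using eng.IH subgroup.m_closed[OF subgroup_stab[OF FJ(2)]] by blast
      fix d i assume d: "d \<in> stab J" and i: "i \<in> I - J"
      have ds: "d \<otimes> s \<in> stab J"
        using d eng.IH subgroup.m_closed[OF subgroup_stab[OF FJ(2)]] by blast
      have as: "d \<otimes> s \<otimes> t = d \<otimes> (s \<otimes> t)"
        by (rule m_assoc) (use d eng.IH stab_carrier in blast)+
      have "((i, (g \<otimes> d) <# H i), (i, (g \<otimes> (d \<otimes> s)) <# H i)) \<in> ?E\<^sup>*"
        using eng.IH(1) d i by blast
      moreover have "((i, (g \<otimes> (d \<otimes> s)) <# H i), (i, (g \<otimes> (d \<otimes> s \<otimes> t)) <# H i)) \<in> ?E\<^sup>*"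
        using eng.IH(2) ds i by blast
      ultimately show "((i, (g \<otimes> d) <# H i), (i, (g \<otimes> (d \<otimes> (s \<otimes> t))) <# H i)) \<in> ?E\<^sup>*"
        unfolding as by (rule rtrancl_trans)
    qed
  qed
  show "connected (with_proj (incidence_graph ?R))"
  proof (rule connected_incidence_graphI)
    show "Elems ?R \<noteq> {}"
    proof -
      have "I - J \<noteq> {}"
      proof
        assume "I - J = {}"
        with rk show False by simp
      qed
      then show ?thesis using El subgroup.one_closed[OF subgroup_stab[OF FJ(2)]] by blast
    qed
    fix x y assume "x \<in> Elems ?R" "y \<in> Elems ?R"
    then obtain i d k e where x: "x = (i, (g \<otimes> d) <# H i)" "i \<in> I - J" "d \<in> stab J"
      and y: "y = (k, (g \<otimes> e) <# H k)" "k \<in> I - J" "e \<in> stab J"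
      unfolding El by blast
    have s: "inv d \<otimes> e \<in> stab J"
      using x y subgroup_stab[OF FJ(2)] subgroup.m_inv_closed subgroup.m_closed by metis
    have "d \<otimes> (inv d \<otimes> e) = e"
      using x(3) y(3) by (simp add: stab_def m_assoc[symmetric])
    then have "(x, (i, (g \<otimes> e) <# H i)) \<in> ?E\<^sup>*"
      using gen[of "inv d \<otimes> e"] s genJ x by fastforce
    moreover have "((i, (g \<otimes> e) <# H i), y) \<in> ?E" using adj x y by blast
    ultimately show "(x, y) \<in> ?E\<^sup>*" by (rule rtrancl_into_rtrancl)
  qed
qed

text \<open>The case \<open>J = I\<close> of the generation axiom: there are no generators left.\<close>
lemma stab_I: "stab I = {\<one>}"
  using generated[of I] generate_empty subgroup.one_closed[OF subgroup_stab[of I]]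
  by (auto simp: stab_def)

lemma card_rank_one_residue:
  assumes i: "i \<in> I" and F: "flag_of_type \<Gamma> (I - {i}) F"
  shows "card (Elems (residue \<Gamma> F)) = card (stab (I - {i}))"
proof -
  obtain g where g: "g \<in> carrier G" "F = std_flag g (I - {i})"
    using F flag_std by (metis flag_of_type_def Gamma_simps(2))
  have "I - (I - {i}) = {i}" using i by auto
  then have "Elems (residue \<Gamma> F) = (\<lambda>d. (i, (g \<otimes> d) <# H i)) ` stab (I - {i})"
    unfolding g(2) Elems_residue[OF g(1), of "I - {i}", OF Diff_subset] by auto
  moreover have "inj_on (\<lambda>d. (i, (g \<otimes> d) <# H i)) (stab (I - {i}))"
  proof (rule inj_onI)
    fix d e assume d: "d \<in> stab (I - {i})" and e: "e \<in> stab (I - {i})"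
      and "(i, (g \<otimes> d) <# H i) = (i, (g \<otimes> e) <# H i)"
    then have "inv (g \<otimes> d) \<otimes> (g \<otimes> e) \<in> H i"
      using coset_eq_iff i g stab_carrier by auto
    also have "inv (g \<otimes> d) \<otimes> (g \<otimes> e) = inv d \<otimes> e"
      using d e g by (simp add: stab_def inv_mult_group m_assoc) (simp add: m_assoc[symmetric])
    finally have "inv d \<otimes> e \<in> H i" .
    moreover have "inv d \<otimes> e \<in> stab (I - {i})"
      using d e subgroup_stab[OF Diff_subset] subgroup.m_inv_closed subgroup.m_closed by metis
    ultimately have "inv d \<otimes> e \<in> stab I" by (auto simp: stab_def)
    then have "inv d \<otimes> e = \<one>" by (simp add: stab_I)
    then show "d = e"
      using inv_equality[of "inv d" e] d e stab_carrier by (metis inv_closed inv_inv inv_comm)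
  qed
  ultimately show ?thesis by (simp add: card_image)
qed

lemma rank_one_residue_type:
  assumes "flag \<Gamma> F" "rank (residue \<Gamma> F) = 1"
  obtains i where "i \<in> I" "flag_of_type \<Gamma> (I - {i}) F"
proof -
  have sub: "fst ` F \<subseteq> I" using assms(1) flag_std by blast
  obtain i where "I - fst ` F = {i}"
    using assms(2) by (auto simp: rank_def card_1_singleton_iff)
  then have "i \<in> I" "fst ` F = I - {i}" using sub by auto
  with assms(1) that show ?thesis by (auto simp: flag_of_type_def)
qed

text \<open>
  With representatives \<open>u\<close> of \<open>x\<close> and \<open>y\<close>, and \<open>v\<close> of \<open>y\<close> and \<open>z\<close>, the quotient
  \<open>u\<inverse> v = a b\<close> lies in the middle subgroup and splits; \<open>u a = v b\<inverse>\<close> then represents both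
  \<open>x\<close> and \<open>z\<close>.
\<close>
lemma incident_trans:
  assumes x: "x \<in> Elems \<Gamma>" and y: "y \<in> Elems \<Gamma>" and z: "z \<in> Elems \<Gamma>"
    and le: "fst x \<le> fst y" "fst y \<le> fst z"
    and inc: "incident \<Gamma> x y" "incident \<Gamma> y z"
  shows "incident \<Gamma> x z"
proof -
  obtain u where u: "u \<in> snd x" "u \<in> snd y" using inc by auto
  obtain v where v: "v \<in> snd y" "v \<in> snd z" using inc by auto
  let ?i = "fst x" let ?j = "fst y" let ?k = "fst z"
  have I: "?i \<in> I" "?j \<in> I" "?k \<in> I" and c: "u \<in> carrier G" "v \<in> carrier G"
    using ElemsD x y z u v by blast+
  have eqs: "snd x = u <# H ?i" "snd z = v <# H ?k" "snd y = u <# H ?j"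
    using ElemsD(3) x y z u v by (metis snd_conv)+
  with v have "inv u \<otimes> v \<in> H ?j" using mem_coset_iff I c by auto
  from split[OF I(2) this] obtain a b where ab: "inv u \<otimes> v = a \<otimes> b" "a \<in> H ?i" "b \<in> H ?k"
    using I le by blast
  have abc: "a \<in> carrier G" "b \<in> carrier G" using ab H_carrier I by blast+
  have "u \<otimes> a \<in> snd x" using eqs mult_in_coset I c ab by simp
  moreover have "u \<otimes> a \<in> snd z"
  proof -
    have "u \<otimes> a = u \<otimes> (a \<otimes> b) \<otimes> inv b" using c abc by (simp add: m_assoc)
    also have "\<dots> = v \<otimes> inv b" using ab(1) c abc by (metis inv_closed m_assoc r_inv l_one)
    finally show ?thesis
      using eqs mult_in_coset I c ab subgroup.m_inv_closed[OF subgroup_H] by simp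
  qed
  ultimately show ?thesis by auto
qed

text \<open>
  The flag defining the residue has an element of type \<open>k\<close>, and incidence passes through it.
\<close>
lemma not_joined:
  assumes "i \<in> I" "j \<in> I" "k \<in> I" "i < k" "k < j"
  shows "\<not> joined \<Gamma> i j" "\<not> joined \<Gamma> j i"
proof -
  have *: "incident \<Gamma> x y \<and> incident \<Gamma> y x"
    if F: "fst ` F = I - {i, j}" "F \<subseteq> Elems \<Gamma>"
      and x: "x \<in> Elems (residue \<Gamma> F)" "fst x = i" and y: "y \<in> Elems (residue \<Gamma> F)" "fst y = j"
    for F x y
  proof -
    have "k \<in> fst ` F" using F assms by auto
    then obtain z where z: "z \<in> F" "fst z = k" by auto
    have inc: "incident \<Gamma> x z" "incident \<Gamma> z y"
      using x y z by (auto simp: residue_def)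
    have el: "x \<in> Elems \<Gamma>" "z \<in> Elems \<Gamma>" "y \<in> Elems \<Gamma>"
      using x y z F by (auto simp: residue_def)
    have "fst x \<le> fst z" "fst z \<le> fst y" using x y z assms by simp_all
    from incident_trans[OF el this inc] show ?thesis by auto
  qed
  have eq: "{j, i} = {i, j}" by auto
  show "\<not> joined \<Gamma> i j" "\<not> joined \<Gamma> j i"
    unfolding joined_def generalized_digon_def flag_of_type_def flag_def eq using * by auto
qed

end

section \<open>The affine plane without one parallel class\<close>

lemma length_4_exhaust:
  assumes "length p = 4" obtains a b c d where "p = [a, b, c, d]"
  using assms that by (auto simp: numeral_eq_Suc length_Suc_conv)

lemma length_6_exhaust:
  assumes "length p = 6" obtains a b c d e f where "p = [a, b, c, d, e, f]"
  using assms that by (auto simp: numeral_eq_Suc length_Suc_conv)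

text \<open>
  Points are pairs \<open>(a, u)\<close>, and the line \<open>(b, c)\<close> is the graph of \<open>u = c - a b\<close>. Vertical lines are
  the missing parallel class.
\<close>
locale affine_net =
  fixes R :: "('x, 'i) incidence_structure" and i j :: 'i
    and P L :: "'f::field \<times> 'f \<Rightarrow> 'x"
  assumes Elems_eq: "Elems R = range P \<union> range L"
    and inj_P: "inj P" and inj_L: "inj L"
    and type_P: "type_of R (P x) = i" and type_L: "type_of R (L y) = j" and types_ne: "i \<noteq> j"
    and inc_PL: "incident R (P (a, u)) (L (b, c)) \<longleftrightarrow> c = u + a * b"
    and inc_LP: "incident R (L (b, c)) (P (a, u)) \<longleftrightarrow> c = u + a * b"
    and inc_PP: "incident R (P x) (P y) \<longleftrightarrow> x = y"
    and inc_LL: "incident R (L x) (L y) \<longleftrightarrow> x = y"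
begin

abbreviation graph :: "('x, 'x \<times> 'x) pre_digraph" where
  "graph \<equiv> with_proj (incidence_graph R)"

abbreviation adj :: "'x \<Rightarrow> 'x \<Rightarrow> bool" where
  "adj x y \<equiv> (x, y) \<in> parcs (incidence_graph R)"

lemma P_neq_L [simp]: "P x \<noteq> L y" "L y \<noteq> P x"
  using type_P type_L types_ne by metis+

lemma P_eq [simp]: "P x = P y \<longleftrightarrow> x = y" and L_eq [simp]: "L x = L y \<longleftrightarrow> x = y"
  using inj_P inj_L by (auto dest: injD)

lemma Elems_P [simp]: "P x \<in> Elems R" and Elems_L [simp]: "L x \<in> Elems R"
  by (auto simp: Elems_eq)

lemma adj_simps [simp]:
  "adj (P (a, u)) (L (b, c)) \<longleftrightarrow> c = u + a * b"
  "adj (L (b, c)) (P (a, u)) \<longleftrightarrow> c = u + a * b"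
  "\<not> adj (P x) (P y)" "\<not> adj (L x) (L y)"
  by (auto simp: incidence_graph_def inc_PL inc_LP inc_PP inc_LL)

lemma Elem_cases:
  assumes "x \<in> Elems R"
  obtains (P) a u where "x = P (a, u)" | (L) b c where "x = L (b, c)"
  using assms unfolding Elems_eq by force

lemma verts_graph [simp]: "verts graph = Elems R" "pverts (incidence_graph R) = Elems R"
  by (simp_all add: incidence_graph_def)

lemma dist_le:
  assumes "vwalk p graph" "hd p = x" "last p = y" "length p \<le> Suc k"
  shows "graph_dist graph x y \<le> enat k"
proof -
  have "graph_dist graph x y \<le> enat (vwalk_length p)"
    unfolding graph_dist_def using assms by (intro INF_lower) auto
  also have "\<dots> \<le> enat k" using assms(4) by simp
  finally show ?thesis .
qed

lemma vwalk_Cons [simp]: "vwalk [x] graph \<longleftrightarrow> x \<in> Elems R"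
  "vwalk (x # y # p) graph \<longleftrightarrow> x \<in> Elems R \<and> adj x y \<and> vwalk (y # p) graph"
  by (auto simp: vwalk_def)

text \<open>
  Points of different columns are joined by the line of the appropriate slope. A point of the same
  column, or a line, is reached by a detour over the column \<open>a + 1\<close>.
\<close>
lemma dist_from_P:
  assumes "y \<in> Elems R"
  shows "graph_dist graph (P (a, u)) y \<le> 4"
  using assms
proof (cases rule: Elem_cases)
  case (P a' u')
  show ?thesis
  proof (cases "a = a'")
    case True
    (* out along the horizontal line, back along the line of slope u' - u *)
    let ?p = "[P (a, u), L (0, u), P (a + 1, u), L (u' - u, u + (a + 1) * (u' - u)), P (a', u')]"
    have "graph_dist graph (P (a, u)) y \<le> enat 4"
      using P True by (intro dist_le[of ?p]) (auto simp: algebra_simps)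
    then show ?thesis by (simp add: numeral_eq_enat)
  next
    case False
    let ?b = "(u' - u) / (a - a')"
    let ?p = "[P (a, u), L (?b, u + a * ?b), P (a', u')]"
    have "graph_dist graph (P (a, u)) y \<le> enat 4"
      using P False by (intro dist_le[of ?p]) (auto simp: field_simps)
    then show ?thesis by (simp add: numeral_eq_enat)
  qed
next
  case (L b c)
  let ?p = "[P (a, u), L (u - (c - (a + 1) * b), u + a * (u - (c - (a + 1) * b))),
     P (a + 1, c - (a + 1) * b), L (b, c)]"
  have "graph_dist graph (P (a, u)) y \<le> enat 4"
    using L by (intro dist_le[of ?p]) (auto simp: algebra_simps)
  then show ?thesis by (simp add: numeral_eq_enat)
qed

text \<open>
  Walks between points have even length, and two points of a column are on no common line.
\<close>
lemma dist_parallel_points: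
  assumes "u \<noteq> u'"
  shows "4 \<le> graph_dist graph (P (a, u)) (P (a, u'))"
  unfolding graph_dist_def
proof (rule INF_greatest, clarify)
  fix p assume p: "vwalk p graph" "hd p = P (a, u)" "last p = P (a, u')"
  have "\<not> length p \<le> 4"
  proof
    assume "length p \<le> 4"
    moreover have "p \<noteq> []" using p(1) by (simp add: vwalk_def)
    ultimately consider x where "p = [x]" | x y where "p = [x, y]" | x y z where "p = [x, y, z]"
      | x y z w where "p = [x, y, z, w]"
      by (cases p rule: list.exhaust; simp)
        (metis One_nat_def Suc_le_length_iff le_Suc_eq le_zero_eq length_0_conv length_Suc_conv
          numeral_3_eq_3)
    then show False
    proof cases
      case (3 x y z)
      have "y \<in> Elems R" using p 3 by auto
      then show False using p 3 assms by (cases rule: Elem_cases) auto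
    next
      case (4 x y z w)
      have "y \<in> Elems R" "z \<in> Elems R" using p 4 by auto
      then show False using p 4 assms by (elim Elem_cases) auto
    qed (use p assms in auto)
  qed
  then show "4 \<le> enat (vwalk_length p)" by (simp add: numeral_eq_enat)
qed

lemma max_dist_from_points: "max_dist_from R i = 4"
proof (rule antisym)
  have "x \<in> range P" if "x \<in> Elems R" "type_of R x = i" for x
    using that type_L types_ne by (auto simp: Elems_eq)
  then show "max_dist_from R i \<le> 4"
    unfolding max_dist_from_def using dist_from_P by (intro SUP_least) fastforce
  have "4 \<le> graph_dist graph (P (0, 0)) (P (0, 1))" by (rule dist_parallel_points) simp
  also have "\<dots> \<le> max_dist_from R i"
    unfolding max_dist_from_def
    by (rule SUP_upper2[of "P (0, 0)"], simp add: type_P, rule SUP_upper2[of "P (0, 1)"]) simp_all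
  finally show "4 \<le> max_dist_from R i" .
qed

text \<open>
  The equation \<open>c = u + a b\<close> is symmetric under exchanging points and lines, up to signs. Hence
  results on distances from points also hold for lines.
\<close>
lemma dual: "affine_net R j i (\<lambda>(b, c). L (b, - c)) (\<lambda>(a, u). P (a, - u))"
proof
  have e: "- u = b * a - c \<longleftrightarrow> c = u + a * b" for a b c u :: 'f
  proof -
    have "- u = x - c \<longleftrightarrow> c = u + x" for x
    proof
      assume h: "- u = x - c"
      have "c = x - (x - c)" by simp
      also have "\<dots> = u + x" unfolding h[symmetric] by simp
      finally show "c = u + x" .
    qed simp
    then show ?thesis by (simp add: mult.commute)
  qed
  have surj: "range (\<lambda>(a, u). f (a, - u)) = range f" for f :: "'f \<times> 'f \<Rightarrow> 'x"
  proof
    have "f z \<in> range (\<lambda>(a, u). f (a, - u))" for z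
      by (rule image_eqI[of _ _ "(fst z, - snd z)"]) simp_all
    then show "range f \<subseteq> range (\<lambda>(a, u). f (a, - u))" by blast
  qed auto
  show "Elems R = range (\<lambda>(b, c). L (b, - c)) \<union> range (\<lambda>(a, u). P (a, - u))"
    unfolding surj by (auto simp: Elems_eq)
  show "incident R (case (a, u) of (b, c) \<Rightarrow> L (b, - c)) (case (b, c) of (a, u) \<Rightarrow> P (a, - u)) \<longleftrightarrow> c = u + a * b"
    "incident R (case (b, c) of (a, u) \<Rightarrow> P (a, - u)) (case (a, u) of (b, c) \<Rightarrow> L (b, - c)) \<longleftrightarrow> c = u + a * b"
    for a u b c by (simp_all add: inc_PL inc_LP e)
qed (use types_ne in \<open>auto simp: inj_def type_P type_L inc_PP inc_LL\<close>)

text \<open>Subtracting the four equations gives \<open>(a - a') (b - b') = 0\<close>.\<close>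
lemma no_digon:
  assumes "adj (P x) (L y)" "adj (P x) (L y')" "adj (P x') (L y)" "adj (P x') (L y')"
  shows "x = x' \<or> y = y'"
proof -
  obtain a u a' u' b c b' c' where
    e: "x = (a, u)" "x' = (a', u')" "y = (b, c)" "y' = (b', c')" by (metis surj_pair)
  have *: "c = u + a * b" "c' = u + a * b'" "c = u' + a' * b" "c' = u' + a' * b'"
    using assms e by auto
  have "a * b = c - u" "a * b' = c' - u" unfolding *(1,2) by simp_all
  moreover have "a' * b = c - u'" "a' * b' = c' - u'" unfolding *(3,4) by simp_all
  ultimately have "(a - a') * (b - b') = 0" unfolding left_diff_distrib right_diff_distrib by simp
  then show ?thesis using * e by auto
qed

text \<open>The incidence graph is bipartite, so that cycles have even length.\<close>
lemma walk_sides: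
  assumes "vwalk p graph"
  shows "(type_of R (last p) = i \<longleftrightarrow> type_of R (hd p) = i) \<longleftrightarrow> odd (length p)"
  using assms
proof (induction p rule: vwalk_induct)
  case (Cons x y p)
  have "adj x y" "x \<in> Elems R" "y \<in> Elems R" using Cons(1) by (auto simp: incidence_graph_def)
  then have "type_of R x = i \<longleftrightarrow> type_of R y \<noteq> i"
    by (elim Elem_cases) (auto simp: type_P type_L types_ne[symmetric])
  then show ?case using Cons(2) by auto
qed auto

lemma cycle_even:
  assumes "graph_cycle graph p"
  shows "even (length p)"
proof -
  have w: "vwalk p graph" "adj (last p) (hd p)" using assms by (auto simp: graph_cycle_def vpath_def)
  have "hd p \<in> Elems R" "last p \<in> Elems R" using w(2) by (auto simp: incidence_graph_def)
  then have "type_of R (last p) = i \<longleftrightarrow> type_of R (hd p) \<noteq> i"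
    using w(2) by (elim Elem_cases) (auto simp: type_P type_L types_ne[symmetric])
  with walk_sides[OF w(1)] show ?thesis by simp
qed

lemma adj_sym: "adj x y \<Longrightarrow> adj y x"
proof -
  assume a: "adj x y"
  then have "x \<in> Elems R" "y \<in> Elems R" by (auto simp: incidence_graph_def)
  then show "adj y x" using a by (elim Elem_cases) auto
qed

lemma adj_P_E:
  assumes "adj (P x) y" obtains z where "y = L z"
proof -
  have "y \<in> Elems R" using assms by (simp add: incidence_graph_def)
  then show ?thesis using assms that by (elim Elem_cases) auto
qed

lemma adj_L_E:
  assumes "adj (L x) y" obtains z where "y = P z"
proof -
  have "y \<in> Elems R" using assms by (simp add: incidence_graph_def)
  then show ?thesis using assms that by (elim Elem_cases) auto
qed

lemma no_square:
  assumes "adj w x" "adj x y" "adj y z" "adj z w" "w \<noteq> y" "x \<noteq> z"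
  shows False
proof -
  have "w \<in> Elems R" using assms by (simp add: incidence_graph_def)
  then show False
  proof (cases rule: Elem_cases)
    case (P a u)
    then show False
      using assms no_digon adj_sym by (metis adj_P_E adj_L_E)
  next
    case (L b c)
    then show False
      using assms no_digon adj_sym by (metis adj_P_E adj_L_E)
  qed
qed

text \<open>
  The three points of a hexagon are pairwise collinear, hence lie in three different columns.
\<close>
lemma hexagon_card:
  assumes "adj (P x) (L l)" "adj (P y) (L l)" "adj (P y) (L m)" "adj (P z) (L m)"
    "adj (P z) (L k)" "adj (P x) (L k)" "x \<noteq> y" "y \<noteq> z" "x \<noteq> z"
  shows "CARD('f) \<noteq> 2"
proof
  assume "CARD('f) = 2"
  then obtain s t :: 'f where st: "UNIV = {s, t}" "s \<noteq> t" by (auto simp: card_2_iff)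
  have ne: "fst x \<noteq> fst y" if "adj (P x) (L l)" "adj (P y) (L l)" "x \<noteq> y" for x y l
    using that by (cases x; cases y; cases l) auto
  have "fst x \<noteq> fst y" "fst y \<noteq> fst z" "fst x \<noteq> fst z" using ne assms by blast+
  moreover have "fst x \<in> {s, t}" "fst y \<in> {s, t}" "fst z \<in> {s, t}" unfolding st(1)[symmetric] by auto
  ultimately show False by auto
qed

lemma cycle_ge_6:
  assumes "graph_cycle graph p"
  shows "6 \<le> length p"
proof -
  have "length p \<noteq> 4"
  proof
    assume "length p = 4"
    then obtain a b c d where p: "p = [a, b, c, d]" by (rule length_4_exhaust)
    show False
      using assms no_square[of a b c d] by (auto simp: p graph_cycle_def vpath_def)
  qed
  moreover have "length p \<ge> 3" using assms by (simp add: graph_cycle_def)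
  moreover have "even (length p)" using assms by (rule cycle_even)
  moreover have "n = 3 \<or> n = 4 \<or> n = 5 \<or> 6 \<le> n" if "3 \<le> n" for n :: nat using that by linarith
  ultimately show ?thesis by (metis even_numeral odd_numeral)
qed

lemma cycle_ge_8:
  assumes p: "graph_cycle graph p" and two: "CARD('f) = 2"
  shows "8 \<le> length p"
proof -
  have "length p \<noteq> 6"
  proof
    assume "length p = 6"
    then obtain a b c d e f where l: "p = [a, b, c, d, e, f]" by (rule length_6_exhaust)
    have adj: "adj a b" "adj b c" "adj c d" "adj d e" "adj e f" "adj f a"
      and ne: "distinct [a, b, c, d, e, f]"
      using p by (auto simp: l graph_cycle_def vpath_def)
    have no: False if h: "adj (P x) b" "adj b c" "adj c d" "adj d e" "adj e f" "adj f (P x)"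
      "distinct [P x, b, c, d, e, f]" for x b c d e f
    proof -
      obtain l where [simp]: "b = L l" using h(1) by (auto elim: adj_P_E)
      obtain y where [simp]: "c = P y" using h(2) by (auto elim: adj_L_E)
      obtain m where [simp]: "d = L m" using h(3) by (auto elim: adj_P_E)
      obtain z where [simp]: "e = P z" using h(4) by (auto elim: adj_L_E)
      obtain k where [simp]: "f = L k" using h(5) by (auto elim: adj_P_E)
      have "x \<noteq> y" "y \<noteq> z" "x \<noteq> z" using h(7) by auto
      then show False
        using hexagon_card[of x l y m z k] h two adj_sym by auto
    qed
    have "a \<in> Elems R" using adj by (simp add: incidence_graph_def)
    then show False
    proof (cases rule: Elem_cases)
      case (P x u)
      then show False using no[of "(x, u)" b c d e f] adj ne by simp
    next
      case (L x u)
      then obtain y where "b = P y" using adj(1) by (auto elim: adj_L_E)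
      then show False using no[of y c d e f a] adj ne by auto
    qed
  qed
  moreover have "length p \<ge> 6" using p by (rule cycle_ge_6)
  moreover have "even (length p)" using p by (rule cycle_even)
  moreover have "n = 6 \<or> n = 7 \<or> 8 \<le> n" if "6 \<le> n" for n :: nat using that by linarith
  ultimately show ?thesis by (metis odd_numeral)
qed

lemma girth_le:
  assumes "graph_cycle graph p" "length p = k"
  shows "girth graph \<le> enat k"
  unfolding girth_def using assms by (intro INF_lower2[of p]) auto

lemma girth_ge:
  assumes "\<And>p. graph_cycle graph p \<Longrightarrow> k \<le> length p"
  shows "enat k \<le> girth graph"
  unfolding girth_def using assms by (intro INF_greatest) auto

text \<open>
  The hexagon is a triangle with a vertex in each of the columns \<open>0\<close>, \<open>1\<close> and \<open>t\<close>: its first two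
  vertices span a line of slope \<open>0\<close>, the third is placed so that the side through the first has
  slope \<open>1\<close>, and \<open>b\<close> is then the slope of the remaining side.
\<close>
lemma girth_6:
  fixes t :: 'f assumes t: "t \<noteq> 0" "t \<noteq> 1"
  shows "girth graph = 6"
proof -
  define b where "b = t / (t - 1)"
  have b: "b \<noteq> 0" "b \<noteq> 1" "b = - t + t * b"
    using t by (auto simp: b_def field_simps)
  let ?p = "[P (0, 0), L (0, 0), P (1, 0), L (b, b), P (t, - t), L (1, 0)]"
  have "graph_cycle graph ?p"
    using t b by (auto simp: graph_cycle_def vpath_def)
  then have "girth graph \<le> enat 6" by (rule girth_le) simp
  moreover have "enat 6 \<le> girth graph" by (rule girth_ge) (rule cycle_ge_6)
  ultimately show ?thesis by (simp add: numeral_eq_enat)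
qed

text \<open>Over the field with two elements all four points and four lines together form one octagon.\<close>
lemma girth_8:
  assumes two: "CARD('f) = 2"
  shows "girth graph = 8"
proof -
  have neg: "(1::'f) + 1 = 0"
  proof -
    obtain s t :: 'f where st: "UNIV = {s, t}" using two by (auto simp: card_2_iff)
    have "(1::'f) + 1 \<in> {s, t}" "1 \<in> {s, t}" "0 \<in> {s, t}" unfolding st[symmetric] by auto
    moreover have "(1::'f) + 1 \<noteq> 1" by (metis add_left_cancel add_0_right zero_neq_one)
    ultimately show ?thesis by (metis insertE singletonD zero_neq_one)
  qed
  let ?p = "[P (0, 0), L (0, 0), P (1, 0), L (1, 1), P (0, 1), L (0, 1), P (1, 1), L (1, 0)]"
  have "graph_cycle graph ?p"
    using neg by (auto simp: graph_cycle_def vpath_def)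
  then have "girth graph \<le> enat 8" by (rule girth_le) simp
  moreover have "enat 8 \<le> girth graph" by (rule girth_ge) (rule cycle_ge_8[OF _ two])
  ultimately show ?thesis by (simp add: numeral_eq_enat)
qed

theorem rank2_parameters:
  assumes "CARD('f) \<ge> 2"
  shows "rank2_parameters R i j (4, if CARD('f) = 2 then 4 else 3, 4)"
proof -
  have "max_dist_from R j = 4" by (rule affine_net.max_dist_from_points[OF dual])
  moreover have "girth graph = (if CARD('f) = 2 then 8 else 6)"
  proof (cases "CARD('f) = 2")
    case False
    have "\<not> UNIV \<subseteq> {0, 1 :: 'f}"
    proof
      assume "UNIV \<subseteq> {0, 1 :: 'f}"
      then have "CARD('f) \<le> card {0, 1 :: 'f}" by (intro card_mono) auto
      then show False using assms False by simp
    qed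
    then obtain t :: 'f where "t \<noteq> 0" "t \<noteq> 1" by blast
    then show ?thesis using False girth_6 by simp
  qed (simp add: girth_8)
  ultimately show ?thesis
    using max_dist_from_points by (simp add: rank2_parameters_def)
qed

end

section \<open>Block diagonal unitriangular groups\<close>

text \<open>
  Rows and columns are counted from \<open>0\<close>, and a break \<open>j\<close> separates the positions \<open>0, ..., j - 1\<close> from
  \<open>j, ..., n - 1\<close>. Thus \<open>linked J r c\<close> says that the position \<open>(r, c)\<close> lies in the upper triangle,
  diagonal included, of one of the diagonal blocks.
\<close>
definition linked :: "nat set \<Rightarrow> nat \<Rightarrow> nat \<Rightarrow> bool" where
  "linked J r c \<longleftrightarrow> r \<le> c \<and> (\<forall>j\<in>J. \<not> (r < j \<and> j \<le> c))"

lemma linked_trans: "linked J r k \<Longrightarrow> linked J k c \<Longrightarrow> linked J r c"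
  unfolding linked_def by (meson le_trans not_less)

lemma linked_refl: "linked J r r"
  by (auto simp: linked_def)

text \<open>
  For \<open>J = {}\<close> this is the full unitriangular group, for \<open>J = {i}\<close> it is \<open>U\<^sub>i\<close>.
\<close>
definition block_unitri :: "nat \<Rightarrow> nat set \<Rightarrow> 'a::field mat set" where
  "block_unitri n J = {A \<in> carrier_mat n n. (\<forall>r<n. A $$ (r, r) = 1) \<and>
     (\<forall>r<n. \<forall>c<n. \<not> linked J r c \<longrightarrow> A $$ (r, c) = 0)}"

lemma block_unitriD:
  assumes "A \<in> block_unitri n J"
  shows "A \<in> carrier_mat n n" "r < n \<Longrightarrow> A $$ (r, r) = 1"
    "r < n \<Longrightarrow> c < n \<Longrightarrow> \<not> linked J r c \<Longrightarrow> A $$ (r, c) = 0"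
  using assms by (auto simp: block_unitri_def)

lemma UT_simps [simp]:
  "mult (UT n) = (*)" "one (UT n) = 1\<^sub>m n"
  by (simp_all add: UT_def)

lemma carrier_UT: "carrier (UT n) = block_unitri n {}"
  by (auto simp: UT_def block_unitri_def upper_triangular_def linked_def not_le)

lemma mult_entry:
  assumes "A \<in> carrier_mat n n" "B \<in> carrier_mat n n" "r < n" "c < n"
  shows "(A * B) $$ (r, c) = (\<Sum>k<n. A $$ (r, k) * B $$ (k, c))"
  using assms by (auto simp: scalar_prod_def atLeast0LessThan)

lemma block_unitri_mult_entry:
  assumes A: "A \<in> block_unitri n J" and B: "B \<in> block_unitri n J" and rc: "r < n" "c < n"
  shows "(A * B) $$ (r, c) = (\<Sum>k | linked J r k \<and> linked J k c. A $$ (r, k) * B $$ (k, c))"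
proof -
  have "(\<Sum>k<n. A $$ (r, k) * B $$ (k, c)) =
      (\<Sum>k | linked J r k \<and> linked J k c. A $$ (r, k) * B $$ (k, c))"
  proof (rule sum.mono_neutral_right)
    show "{k. linked J r k \<and> linked J k c} \<subseteq> {..<n}"
      using rc by (auto simp: linked_def)
    show "\<forall>k\<in>{..<n} - {k. linked J r k \<and> linked J k c}. A $$ (r, k) * B $$ (k, c) = 0"
      using block_unitriD(3)[OF A] block_unitriD(3)[OF B] rc by auto
  qed simp
  then show ?thesis
    using mult_entry[OF block_unitriD(1)[OF A] block_unitriD(1)[OF B] rc] by simp
qed

text \<open>
  Linkedness is a partial order, and matrices supported on a partial order with unit diagonal are
  closed under multiplication, as in an incidence algebra.
\<close>
lemma block_unitri_mult:
  assumes A: "A \<in> block_unitri n J" and B: "B \<in> block_unitri n J"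
  shows "A * B \<in> block_unitri n J"
  unfolding block_unitri_def
proof (intro CollectI conjI allI impI)
  show "A * B \<in> carrier_mat n n" using A B block_unitriD(1) by (intro mult_carrier_mat)
  show "(A * B) $$ (r, r) = 1" if "r < n" for r
  proof -
    have "{k. linked J r k \<and> linked J k r} = {r}" by (auto simp: linked_def)
    then show ?thesis
      using block_unitri_mult_entry[OF A B that that] block_unitriD(2)[OF A that]
        block_unitriD(2)[OF B that] by simp
  qed
  show "(A * B) $$ (r, c) = 0" if "r < n" "c < n" "\<not> linked J r c" for r c
  proof -
    have "{k. linked J r k \<and> linked J k c} = {}" using linked_trans that by blast
    then show ?thesis by (simp only: block_unitri_mult_entry[OF A B that(1,2)] sum.empty)
  qed
qed

lemma block_unitri_one: "1\<^sub>m n \<in> block_unitri n J"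
  using linked_refl by (auto simp: block_unitri_def)

lemma block_unitri_antimono: "J \<subseteq> K \<Longrightarrow> block_unitri n K \<subseteq> block_unitri n J"
proof -
  assume "J \<subseteq> K"
  then have "\<not> linked J r c \<Longrightarrow> \<not> linked K r c" for r c by (auto simp: linked_def)
  then show ?thesis unfolding block_unitri_def by fastforce
qed

lemma elementary_block_unitri:
  assumes "r < c" "c < n" "linked J r c"
  shows "addrow_mat n t r c \<in> block_unitri n J"
  using assms by (auto simp: block_unitri_def linked_refl)

lemma e_mat_addrow: "1 \<le> j \<Longrightarrow> j < n \<Longrightarrow> e_mat n j t = addrow_mat n t (j - 1) j"
  by (intro eq_matI) (auto simp: e_mat_def)

text \<open>
  Gaussian elimination as an induction principle. Let \<open>r\<close> be the last row with a nonzero entry off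
  the diagonal, and \<open>(r, c)\<close> such an entry. The row \<open>c\<close> is below \<open>r\<close> and thus is that of the
  identity, so an elementary row operation clears the entry \<open>(r, c)\<close> and changes no other one.
\<close>
lemma block_unitri_induct [consumes 1, case_names one mult]:
  assumes "A \<in> block_unitri n J"
    and one: "P (1\<^sub>m n)"
    and mult: "\<And>a r c B. \<lbrakk>r < c; c < n; linked J r c; B \<in> block_unitri n J; P B\<rbrakk>
      \<Longrightarrow> P (addrow_mat n a r c * B)"
  shows "P A"
proof -
  define off :: "'a mat \<Rightarrow> (nat \<times> nat) set" where
    "off A = {(r, c). r < n \<and> c < n \<and> r \<noteq> c \<and> A $$ (r, c) \<noteq> 0}" for A
  have fin: "finite (off A)" for A
    by (rule finite_subset[of _ "{..<n} \<times> {..<n}"]) (auto simp: off_def)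
  show ?thesis
    using assms(1)
  proof (induction "card (off A)" arbitrary: A rule: less_induct)
    case less
    note A = block_unitriD[OF less.prems]
    show ?case
    proof (cases "off A = {}")
      case True
      then have "A = 1\<^sub>m n" using A by (intro eq_matI) (auto simp: off_def)
      then show ?thesis using one by simp
    next
      case False
      define r where "r = Max (fst ` off A)"
      have "r \<in> fst ` off A" using False fin by (simp add: r_def)
      then obtain c where rc: "(r, c) \<in> off A" by auto
      then have rc': "r < n" "c < n" "linked J r c" "r \<noteq> c" "A $$ (r, c) \<noteq> 0"
        using A(3)[of r c] by (auto simp: off_def)
      then have "r < c" by (simp add: linked_def)
      note rc' = this rc'
      have "k \<le> r" if "(k, x) \<in> off A" for k x
        using that fin by (force simp: r_def intro: Max_ge)
      then have below: "A $$ (c, x) = (if x = c then 1 else 0)" if "x < n" for x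
        using that rc' A(2) by (force simp: off_def)
      define B where "B = mat n n (\<lambda>(i, j). if i = r \<and> j = c then 0 else A $$ (i, j))"
      have B: "B \<in> block_unitri n J" using A rc' by (auto simp: block_unitri_def B_def)
      have "off B = off A - {(r, c)}" by (auto simp: off_def B_def split: if_splits)
      then have "card (off B) < card (off A)" using rc fin by (intro psubset_card_mono) auto
      then have "P B" using less.hyps B by blast
      moreover have "addrow_mat n (A $$ (r, c)) r c * B = A"
      proof -
        have "addrow_mat n (A $$ (r, c)) r c * B = addrow (A $$ (r, c)) r c B"
          using addrow_mat[of B n n c] rc' block_unitriD(1)[OF B] by simp
        also have "\<dots> = A" using A rc' below by (intro eq_matI) (auto simp: B_def)
        finally show ?thesis .
      qed
      ultimately show ?thesis using mult[of r c B "A $$ (r, c)"] rc' B by simp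
    qed
  qed
qed

lemma block_unitri_left_inverse:
  assumes "A \<in> block_unitri n J"
  shows "\<exists>B\<in>block_unitri n J. B * A = 1\<^sub>m n"
  using assms
proof (induction rule: block_unitri_induct)
  case one
  then show ?case using block_unitri_one[of n J] by (intro bexI[of _ "1\<^sub>m n"]) auto
next
  case (mult a r c A)
  then obtain B where B: "B \<in> block_unitri n J" "B * A = 1\<^sub>m n" by auto
  let ?E = "addrow_mat n a r c" and ?F = "addrow_mat n (- a) r c"
  have cs: "A \<in> carrier_mat n n" "B \<in> carrier_mat n n" using mult B block_unitriD(1) by blast+
  have FE: "?F * ?E = 1\<^sub>m n" using addrow_mat_inv[of r n c "- a"] mult by simp
  have "(B * ?F) * (?E * A) = B * (?F * (?E * A))"
    using cs by (intro assoc_mult_mat[of _ n n _ n _ n]) auto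
  also have "?F * (?E * A) = (?F * ?E) * A"
    using cs by (intro assoc_mult_mat[symmetric, of _ n n _ n _ n]) auto
  also have "B * \<dots> = 1\<^sub>m n" using cs B FE by simp
  finally have "(B * ?F) * (?E * A) = 1\<^sub>m n" .
  moreover have "B * ?F \<in> block_unitri n J"
    using B mult elementary_block_unitri block_unitri_mult by blast
  ultimately show ?case by blast
qed

lemma group_UT: "group (UT n :: 'a::field mat monoid)"
proof (rule groupI)
  fix A B C :: "'a mat"
  assume "A \<in> carrier (UT n)" "B \<in> carrier (UT n)" "C \<in> carrier (UT n)"
  then show "A \<otimes>\<^bsub>UT n\<^esub> B \<otimes>\<^bsub>UT n\<^esub> C = A \<otimes>\<^bsub>UT n\<^esub> (B \<otimes>\<^bsub>UT n\<^esub> C)"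
    unfolding UT_simps carrier_UT
    by (intro assoc_mult_mat[of _ n n _ n _ n]) (auto dest: block_unitriD(1))
qed (auto simp: carrier_UT block_unitri_one block_unitri_mult
      dest: block_unitriD(1) block_unitri_left_inverse)

lemma subgroup_block_unitri: "subgroup (block_unitri n J) (UT n :: 'a::field mat monoid)"
proof -
  interpret U: group "UT n :: 'a mat monoid" by (rule group_UT)
  show ?thesis
  proof (rule U.subgroupI)
    show "block_unitri n J \<subseteq> carrier (UT n :: 'a mat monoid)"
      unfolding carrier_UT by (rule block_unitri_antimono) simp
    show "block_unitri n J \<noteq> ({} :: 'a mat set)" using block_unitri_one by blast
    fix A B :: "'a mat" assume A: "A \<in> block_unitri n J"
    obtain C where C: "C \<in> block_unitri n J" "C * A = 1\<^sub>m n"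
      using block_unitri_left_inverse[OF A] by blast
    have "inv\<^bsub>UT n\<^esub> A = C"
      using U.inv_equality[of C A] A C block_unitri_antimono[of "{}" J n] by (auto simp: carrier_UT)
    then show "inv\<^bsub>UT n\<^esub> A \<in> block_unitri n J" using C by simp
    assume "B \<in> block_unitri n J"
    then show "A \<otimes>\<^bsub>UT n\<^esub> B \<in> block_unitri n J" using A by (simp add: block_unitri_mult)
  qed
qed

lemma elementary_add:
  assumes "r < c" "c < n"
  shows "addrow_mat n s r c * addrow_mat n t r c = addrow_mat n (s + t) r c"
proof -
  have "addrow_mat n s r c * addrow_mat n t r c = addrow s r c (addrow_mat n t r c)"
    using addrow_mat[of "addrow_mat n t r c" n n c] assms by simp
  also have "\<dots> = addrow_mat n (s + t) r c" using assms by (intro eq_matI) auto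
  finally show ?thesis .
qed

lemma elementary_commutator:
  fixes t :: "'a::field"
  assumes "r < k" "k < c" "c < n"
  shows "addrow_mat n t r k * (addrow_mat n 1 k c * (addrow_mat n (- t) r k * addrow_mat n (- 1) k c))
    = addrow_mat n t r c"
proof -
  have "addrow_mat n t r k * (addrow_mat n 1 k c * (addrow_mat n (- t) r k * addrow_mat n (- 1) k c))
    = addrow t r k (addrow 1 k c (addrow (- t) r k (addrow_mat n (- 1) k c)))"
    using assms by (simp add: addrow_mat[symmetric, of _ n n])
  also have "\<dots> = addrow_mat n t r c" using assms by (intro eq_matI) auto
  finally show ?thesis .
qed

text \<open>
  The elementary matrices at linked positions belong to \<open>K\<close> by induction on the distance from the
  diagonal, as commutators. By elimination they generate.
\<close>
lemma block_unitri_subset_subgroup: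
  fixes K :: "'a::field mat set"
  assumes K: "subgroup K (UT n)"
    and gens: "\<And>k t. \<lbrakk>1 \<le> k; k < n; k \<notin> J\<rbrakk> \<Longrightarrow> addrow_mat n t (k - 1) k \<in> K"
  shows "block_unitri n J \<subseteq> K"
proof
  have mult: "A * B \<in> K" if "A \<in> K" "B \<in> K" for A B
    using subgroup.m_closed[OF K that] by simp
  have elem: "addrow_mat n t r c \<in> K" if "linked J r c" "r < c" "c < n" for t r c
    using that
  proof (induction c arbitrary: t)
    case (Suc k)
    have k: "Suc k \<notin> J" using Suc.prems by (auto simp: linked_def)
    have step: "addrow_mat n s k (Suc k) \<in> K" for s
      using gens[of "Suc k" s] Suc.prems k by simp
    show ?case
    proof (cases "r = k")
      case False
      then have "linked J r k" "r < k" "k < n" using Suc.prems by (auto simp: linked_def)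
      then have "addrow_mat n s r k \<in> K" for s by (rule Suc.IH)
      then show ?thesis
        using elementary_commutator[of r k "Suc k" n t] step Suc.prems False mult
        by (metis lessI less_antisym)
    qed (simp add: step)
  qed simp
  fix A :: "'a mat" assume "A \<in> block_unitri n J"
  then show "A \<in> K"
  proof (induction rule: block_unitri_induct)
    case one
    then show ?case using subgroup.one_closed[OF K] by simp
  qed (simp add: elem mult)
qed

text \<open>
  The factorisation \<open>diag(A\<^sub>1, A\<^sub>2) = diag(1, A\<^sub>2) diag(A\<^sub>1, 1)\<close> with \<open>A\<^sub>1\<close> of size \<open>j\<close>.
\<close>
lemma block_unitri_split:
  assumes A: "A \<in> block_unitri n {j}"
  shows "\<exists>B C. A = B * C \<and> (\<forall>i\<le>j. B \<in> block_unitri n {i}) \<and> (\<forall>k\<ge>j. C \<in> block_unitri n {k})"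
proof -
  note AD = block_unitriD[OF A]
  define B where "B = mat n n (\<lambda>(r, c). if j \<le> r then A $$ (r, c) else if r = c then 1 else 0)"
  define C where "C = mat n n (\<lambda>(r, c). if c < j then A $$ (r, c) else if r = c then 1 else 0)"
  have B: "B \<in> block_unitri n {i}" if "i \<le> j" for i
    using AD that by (auto simp: block_unitri_def B_def linked_def)
  have C: "C \<in> block_unitri n {k}" if "j \<le> k" for k
    using AD that by (auto simp: block_unitri_def C_def linked_def)
  have cs: "B \<in> carrier_mat n n" "C \<in> carrier_mat n n" by (auto simp: B_def C_def)
  have "A = B * C"
  proof (rule eq_matI)
    fix r c assume "r < dim_row (B * C)" "c < dim_col (B * C)"
    then have rc: "r < n" "c < n" using cs by auto
    have "(B * C) $$ (r, c) = (\<Sum>k<n. B $$ (r, k) * C $$ (k, c))"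
      using mult_entry[OF cs rc] .
    also have "\<dots> = A $$ (r, c)"
    proof (cases "j \<le> r")
      case True
      have "(\<Sum>k<n. B $$ (r, k) * C $$ (k, c)) = (\<Sum>k<n. if k = c then A $$ (r, c) else 0)"
      proof (rule sum.cong)
        fix k assume "k \<in> {..<n}"
        then show "B $$ (r, k) * C $$ (k, c) = (if k = c then A $$ (r, c) else 0)"
          using rc True AD(2)[of c] AD(3)[of r k] AD(3)[of k c] AD(3)[of r c]
          by (cases "k < r"; cases "c < j") (auto simp: B_def C_def linked_def)
      qed simp
      then show ?thesis using rc by simp
    next
      case False
      have "(\<Sum>k<n. B $$ (r, k) * C $$ (k, c)) = (\<Sum>k<n. if k = r then C $$ (r, c) else 0)"
        using rc False by (intro sum.cong) (auto simp: B_def)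
      also have "\<dots> = A $$ (r, c)"
        using rc False AD(3)[of r c] by (auto simp: C_def linked_def)
      finally show ?thesis .
    qed
    finally show "A $$ (r, c) = (B * C) $$ (r, c)" by simp
  qed (use AD(1) cs in auto)
  then show ?thesis using B C by blast
qed

lemma block_unitri_Inter:
  "carrier (UT n) \<inter> (\<Inter>j\<in>J. block_unitri n {j}) = (block_unitri n J :: 'a::field mat set)"
proof -
  have "A \<in> block_unitri n J"
    if A: "A \<in> block_unitri n {}" "\<And>j. j \<in> J \<Longrightarrow> A \<in> block_unitri n {j}" for A :: "'a mat"
    unfolding block_unitri_def
  proof (intro CollectI conjI allI impI)
    fix r c assume rc: "r < n" "c < n" and "\<not> linked J r c"
    then consider "\<not> linked {} r c" | j where "j \<in> J" "\<not> linked {j} r c"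
      by (auto simp: linked_def)
    then show "A $$ (r, c) = 0" using A rc by cases (auto dest: block_unitriD(3))
  qed (use block_unitriD[OF A(1)] in auto)
  moreover have "block_unitri n J \<subseteq> (block_unitri n {j} :: 'a mat set)" if "j \<in> J" for j
    using that by (intro block_unitri_antimono) simp
  moreover have "block_unitri n J \<subseteq> (block_unitri n {} :: 'a mat set)"
    by (rule block_unitri_antimono) simp
  ultimately show ?thesis unfolding carrier_UT by blast
qed

theorem linear_coset_geometry_UT:
  "linear_coset_geometry (UT n :: 'a::field mat monoid) {1..n-1} (\<lambda>i. block_unitri n {i})"
proof -
  interpret U: group "UT n :: 'a mat monoid" by (rule group_UT)
  show ?thesis
  proof (intro linear_coset_geometry.intro linear_coset_geometry_axioms.intro group_UT)
    show "subgroup (block_unitri n {i}) (UT n :: 'a mat monoid)" for i by (rule subgroup_block_unitri)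
    show "\<exists>B C. A = B \<otimes>\<^bsub>UT n\<^esub> C \<and> (\<forall>i\<in>{1..n-1}. i \<le> j \<longrightarrow> B \<in> block_unitri n {i}) \<and>
        (\<forall>k\<in>{1..n-1}. j \<le> k \<longrightarrow> C \<in> block_unitri n {k})"
      if "A \<in> block_unitri n {j}" for j and A :: "'a mat"
      using block_unitri_split[OF that] by (auto simp del: Collect_const)
    fix J :: "nat set" assume "J \<subseteq> {1..n-1}"
    let ?X = "\<Union>i\<in>{1..n-1} - J. block_unitri n ({1..n-1} - {i}) :: 'a mat set"
    have "?X \<subseteq> carrier (UT n)" using subgroup.subset[OF subgroup_block_unitri] by blast
    then have "subgroup (generate (UT n) ?X) (UT n)" by (rule U.generate_is_subgroup)
    moreover have "addrow_mat n t (k - 1) k \<in> generate (UT n) ?X"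
      if "1 \<le> k" "k < n" "k \<notin> J" for k and t :: 'a
    proof -
      have "linked ({1..n-1} - {k}) (k - 1) k" by (auto simp: linked_def)
      then have "addrow_mat n t (k - 1) k \<in> block_unitri n ({1..n-1} - {k})"
        using that by (intro elementary_block_unitri) auto
      then show ?thesis using that by (intro generate.incl) force
    qed
    ultimately have "block_unitri n J \<subseteq> generate (UT n) ?X"
      by (rule block_unitri_subset_subgroup)
    then show "carrier (UT n) \<inter> (\<Inter>j\<in>J. block_unitri n {j}) \<subseteq> generate (UT n)
        (\<Union>i\<in>{1..n-1} - J. carrier (UT n) \<inter> (\<Inter>j\<in>{1..n-1} - {i}. block_unitri n {j} :: 'a mat set))"
      unfolding block_unitri_Inter .
  qed simp
qed

text \<open>
  The parameters of the elementary matrices in a subgroup are closed under addition, hence also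
  under scaling by the prime field, whose elements act as sums of ones.
\<close>
lemma elementary_span_in_subgroup:
  fixes K :: "'a::field mat set" and T :: "'a set"
  assumes char: "CHAR('a) = CARD('p::prime_card)" and T: "Fp_basis TYPE('p) T"
    and K: "subgroup K (UT n)" and rc: "r < c" "c < n"
    and gens: "\<And>t. t \<in> T \<Longrightarrow> addrow_mat n t r c \<in> K"
  shows "addrow_mat n t r c \<in> K"
proof -
  interpret V: vector_space "Fp_scale :: 'p mod_ring \<Rightarrow> 'a \<Rightarrow> 'a"
    using char by (rule vector_space_Fp_scale)
  let ?S = "{t. addrow_mat n t r c \<in> K}"
  have zero: "0 \<in> ?S"
  proof -
    have "addrow_mat n (0 :: 'a) r c = 1\<^sub>m n" using rc by (intro eq_matI) auto
    then show ?thesis using subgroup.one_closed[OF K] by simp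
  qed
  have add: "s + t \<in> ?S" if "s \<in> ?S" "t \<in> ?S" for s t
    using subgroup.m_closed[OF K, of "addrow_mat n s r c" "addrow_mat n t r c"]
      elementary_add[OF rc, of s t] that by simp
  have nat: "of_nat m * t \<in> ?S" if "t \<in> ?S" for m t
    by (induction m) (use zero add that in \<open>auto simp: distrib_right\<close>)
  have scale: "Fp_scale x t \<in> ?S" if "t \<in> ?S" for x :: "'p mod_ring" and t
  proof -
    have "to_int_mod_ring x \<in> {0..<int CARD('p)}"
      using range_to_int_mod_ring[where 'a = 'p] by blast
    then have "0 \<le> to_int_mod_ring x" by simp
    then have "Fp_scale x t = of_nat (nat (to_int_mod_ring x)) * t"
      by (simp add: Fp_scale_def of_nat_nat)
    then show ?thesis using nat[OF that] by metis
  qed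
  have "V.subspace ?S"
    using zero add scale by (intro V.subspaceI) auto
  then have "V.span T \<subseteq> ?S" using gens by (intro V.span_minimal) auto
  then show ?thesis using T by (auto simp: Fp_basis_def)
qed

lemma CHAR_eq_of_card:
  assumes "CARD('a::{field,finite}) = p ^ m" "prime p"
  shows "CHAR('a) = p"
proof -
  have "CHAR('a) dvd p ^ m" using CHAR_dvd_CARD[where 'a = 'a] assms by simp
  moreover have "prime CHAR('a)"
    by (rule prime_CHAR_semidom) (simp add: finite_imp_CHAR_pos)
  ultimately show ?thesis using assms(2) by (metis prime_dvd_power primes_dvd_imp_eq)
qed

lemma generate_eq_block_unitri:
  fixes T :: "'a::{field,finite} set"
  assumes char: "CHAR('a) = CARD('p::prime_card)" and T: "Fp_basis TYPE('p) T"
  shows "generate (UT n) {e_mat n j t | j t. t \<in> T \<and> j \<in> {1..n-1} - J} = block_unitri n J"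
    (is "generate _ ?X = _")
proof
  interpret U: group "UT n :: 'a mat monoid" by (rule group_UT)
  have X: "?X \<subseteq> block_unitri n J"
  proof clarify
    fix j and t :: 'a assume j: "j \<in> {1..n-1}" "j \<notin> J"
    have "k = j" if "j - 1 < k" "k \<le> j" for k using that by linarith
    then have "linked J (j - 1) j" using j(2) unfolding linked_def by fastforce
    with j show "e_mat n j t \<in> block_unitri n J"
      using e_mat_addrow[of j n t] elementary_block_unitri[of "j - 1" j n J t] by auto
  qed
  then show "generate (UT n) ?X \<subseteq> block_unitri n J"
    by (rule U.generate_subgroup_incl[OF _ subgroup_block_unitri])
  have "?X \<subseteq> carrier (UT n)" using X subgroup.subset[OF subgroup_block_unitri] by blast
  then have K: "subgroup (generate (UT n) ?X) (UT n)" by (rule U.generate_is_subgroup)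
  show "block_unitri n J \<subseteq> generate (UT n) ?X"
  proof (rule block_unitri_subset_subgroup[OF K])
    fix k and t :: 'a assume k: "1 \<le> k" "k < n" "k \<notin> J"
    have gen: "addrow_mat n s (k - 1) k \<in> generate (UT n) ?X" if "s \<in> T" for s
    proof (rule generate.incl)
      have "addrow_mat n s (k - 1) k = e_mat n k s" using k by (simp add: e_mat_addrow)
      then show "addrow_mat n s (k - 1) k \<in> ?X" using that k by force
    qed
    show "addrow_mat n t (k - 1) k \<in> generate (UT n) ?X"
      by (rule elementary_span_in_subgroup[OF char T K _ k(2) gen]) (use k in simp)
  qed
qed

section \<open>Residues of rank one and two\<close>

lemma card_block_unitri_root:
  assumes "1 \<le> i" "i < n"
  shows "card (block_unitri n ({1..n-1} - {i}) :: 'a::field mat set) = CARD('a)"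
proof -
  let ?B = "block_unitri n ({1..n-1} - {i}) :: 'a mat set"
  have linked: "linked ({1..n-1} - {i}) r c \<longleftrightarrow> r = c \<or> (r = i - 1 \<and> c = i)" if "c < n" for r c
  proof
    assume l: "linked ({1..n-1} - {i}) r c"
    have in_gap: "j = i" if "r < j" "j \<le> c" for j
      using l that \<open>c < n\<close> by (force simp: linked_def)
    have "r \<le> c" using l by (simp add: linked_def)
    then show "r = c \<or> (r = i - 1 \<and> c = i)"
      using in_gap[of "r + 1"] in_gap[of c] by (cases "r = c") auto
  qed (use assms in \<open>auto simp: linked_def\<close>)
  have "bij_betw (\<lambda>t. addrow_mat n t (i - 1) i) (UNIV :: 'a set) ?B"
  proof (rule bij_betwI[where g = "\<lambda>A. A $$ (i - 1, i)"])
    show "(\<lambda>t. addrow_mat n t (i - 1) i) \<in> UNIV \<rightarrow> ?B"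
      using assms linked by (auto intro!: elementary_block_unitri)
    show "addrow_mat n (A $$ (i - 1, i)) (i - 1) i = A" if A: "A \<in> ?B" for A
      using block_unitriD[OF A] assms linked by (intro eq_matI) auto
  qed (use assms in auto)
  then show ?thesis using bij_betw_same_card by fastforce
qed

text \<open>
  The three-dimensional Heisenberg group, placed at the rows and columns \<open>i - 1, i, i + 1\<close>. It is the
  stabiliser of a flag whose type lacks \<open>i\<close> and \<open>i + 1\<close>.
\<close>
definition heisenberg :: "nat \<Rightarrow> nat \<Rightarrow> 'a::field \<Rightarrow> 'a \<Rightarrow> 'a \<Rightarrow> 'a mat" where
  "heisenberg n i a b c = mat n n (\<lambda>(r, s). if r = s then 1 else if r + 1 = i \<and> s = i then a
     else if r = i \<and> s = i + 1 then b else if r + 1 = i \<and> s = i + 1 then c else 0)"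

context
  fixes n i :: nat
  assumes i: "1 \<le> i" "i + 1 < n"
begin

abbreviation (input) ent_a :: "'a mat \<Rightarrow> 'a" where "ent_a A \<equiv> A $$ (i - Suc 0, i)"
abbreviation (input) ent_b :: "'a mat \<Rightarrow> 'a" where "ent_b A \<equiv> A $$ (i, Suc i)"
abbreviation (input) ent_c :: "'a mat \<Rightarrow> 'a" where "ent_c A \<equiv> A $$ (i - Suc 0, Suc i)"

lemma heisenberg_entries [simp]:
  "ent_a (heisenberg n i a b c) = a" "ent_b (heisenberg n i a b c) = b"
  "ent_c (heisenberg n i a b c) = c"
  using i by (auto simp: heisenberg_def)

text \<open>
  The entry \<open>(r, c)\<close> of a product only involves indices between \<open>r\<close> and \<open>c\<close>. Stating this for all
  unitriangular matrices allows cosets of the full groups \<open>U\<^sub>i\<close> to be told apart by these entries.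
\<close>
lemma entries_mult:
  fixes A B :: "'a::field mat"
  assumes A: "A \<in> block_unitri n {}" and B: "B \<in> block_unitri n {}"
  shows "ent_a (A * B) = ent_a A + ent_a B" "ent_b (A * B) = ent_b A + ent_b B"
    "ent_c (A * B) = ent_c A + ent_a A * ent_b B + ent_c B"
proof -
  have *: "{k. linked {} r k \<and> linked {} k c} = {r..c}" for r c by (auto simp: linked_def)
  have s: "{i - Suc 0..i} = {i - Suc 0, i}" "{i..Suc i} = {i, Suc i}" "{i - Suc 0..Suc i} = {i - Suc 0, i, Suc i}"
    using i by auto
  have ne: "i - Suc 0 \<noteq> i" "i - Suc 0 \<noteq> Suc i" "i \<noteq> i - Suc 0" "Suc i \<noteq> i - Suc 0" using i by auto
  have lt: "i - Suc 0 < n" "i < n" "Suc i < n" using i by auto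
  note e = block_unitri_mult_entry[OF A B, unfolded *]
  note d = lt[THEN block_unitriD(2)[OF A]] lt[THEN block_unitriD(2)[OF B]]
  show "ent_a (A * B) = ent_a A + ent_a B"
    unfolding e[OF lt(1,2)] s using d ne by (simp add: add.commute)
  show "ent_b (A * B) = ent_b A + ent_b B"
    unfolding e[OF lt(2,3)] s using d ne by (simp add: add.commute)
  show "ent_c (A * B) = ent_c A + ent_a A * ent_b B + ent_c B"
    unfolding e[OF lt(1,3)] s using d ne by (simp add: add_ac)
qed

lemma linked_rank2:
  assumes "c < n"
  shows "linked ({1..n-1} - {i, i + 1}) r c \<longleftrightarrow>
    r = c \<or> (r = i - 1 \<and> c = i) \<or> (r = i \<and> c = i + 1) \<or> (r = i - 1 \<and> c = i + 1)"
proof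
  assume l: "linked ({1..n-1} - {i, i + 1}) r c"
  then have in_gap: "j = i \<or> j = i + 1" if "r < j" "j \<le> c" for j
    using that assms by (force simp: linked_def)
  have "r \<le> c" using l by (simp add: linked_def)
  then show "r = c \<or> (r = i - 1 \<and> c = i) \<or> (r = i \<and> c = i + 1) \<or> (r = i - 1 \<and> c = i + 1)"
    using in_gap[of "r + 1"] in_gap[of c] by (cases "r = c") auto
qed (use i in \<open>auto simp: linked_def\<close>)

lemma heisenberg_block_unitri: "heisenberg n i a b c \<in> block_unitri n ({1..n-1} - {i, i + 1})"
  using linked_rank2 i by (auto simp: block_unitri_def heisenberg_def)

lemma block_unitri_rank2_eqI:
  fixes A B :: "'a::field mat"
  assumes A: "A \<in> block_unitri n ({1..n-1} - {i, i + 1})"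
    and B: "B \<in> block_unitri n ({1..n-1} - {i, i + 1})"
    and eq: "ent_a A = ent_a B" "ent_b A = ent_b B" "ent_c A = ent_c B"
  shows "A = B"
proof (rule eq_matI)
  fix r c assume "r < dim_row B" "c < dim_col B"
  then have "r < n" "c < n" using block_unitriD(1)[OF B] by auto
  then show "A $$ (r, c) = B $$ (r, c)"
    using block_unitriD(2,3)[OF A] block_unitriD(2,3)[OF B] eq linked_rank2[of c r]
    by (cases "linked ({1..n-1} - {i, i + 1}) r c") auto
qed (use block_unitriD(1)[OF A] block_unitriD(1)[OF B] in auto)

lemma block_unitri_UT: "A \<in> block_unitri n J \<Longrightarrow> A \<in> block_unitri n {}"
  using block_unitri_antimono[of "{}" J n] by auto

lemma heisenberg_mult:
  fixes a b c :: "'a::field"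
  shows "heisenberg n i a b c * heisenberg n i a' b' c' = heisenberg n i (a + a') (b + b') (c + a * b' + c')"
  using entries_mult[OF heisenberg_block_unitri[THEN block_unitri_UT] heisenberg_block_unitri[THEN block_unitri_UT]]
  by (intro block_unitri_rank2_eqI block_unitri_mult heisenberg_block_unitri) simp_all

lemma entries_vertex_stabilisers:
  fixes A :: "'a::field mat"
  shows "A \<in> block_unitri n {i} \<Longrightarrow> ent_a A = 0" "A \<in> block_unitri n {i} \<Longrightarrow> ent_c A = 0"
    "A \<in> block_unitri n {i + 1} \<Longrightarrow> ent_b A = 0" "A \<in> block_unitri n {i + 1} \<Longrightarrow> ent_c A = 0"
  using i by (auto intro!: block_unitriD(3) simp: linked_def)

lemma heisenberg_vertex_stabilisers:
  "heisenberg n i 0 b 0 \<in> block_unitri n {i}" "heisenberg n i a 0 0 \<in> block_unitri n {i + 1}"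
  using i by (auto simp: block_unitri_def heisenberg_def linked_def)

text \<open>
  Right multiplication by \<open>U\<^sub>i\<close> does not change \<open>a\<close> and \<open>c - a b\<close>, and right multiplication by
  \<open>U\<^sub>i\<^sub>+\<^sub>1\<close> does not change \<open>b\<close> and \<open>c\<close>. So these pairs are coordinates of the cosets. If a point \<open>(a, u)\<close> and a
  line \<open>(b, c)\<close> share an element, its entries yield \<open>c = u + a b\<close>; conversely the matrix
  with entries \<open>a, b, c\<close> is in both.
\<close>
theorem affine_net_residue:
  fixes g :: "'a::field mat"
  assumes g: "g \<in> carrier (UT n)"
  defines "\<Gamma> \<equiv> coset_incidence_system (UT n) {1..n-1} (\<lambda>i. block_unitri n {i})"
    and "F \<equiv> (\<lambda>j. (j, g <#\<^bsub>UT n\<^esub> block_unitri n {j})) ` ({1..n-1} - {i, i + 1})"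
  shows "affine_net (residue \<Gamma> F) i (i + 1)
    (\<lambda>(a, u). (i, (g * heisenberg n i a 0 u) <#\<^bsub>UT n\<^esub> block_unitri n {i}))
    (\<lambda>(b, c). (i + 1, (g * heisenberg n i 0 b c) <#\<^bsub>UT n\<^esub> block_unitri n {i + 1}))"
proof -
  interpret U: linear_coset_geometry "UT n :: 'a mat monoid" "{1..n-1}" "\<lambda>i. block_unitri n {i}"
    by (rule linear_coset_geometry_UT)
  let ?I = "{1..n-1}" and ?J = "{1..n-1} - {i, i + 1}"
  define P where "P = (\<lambda>(a, u). (i, (g * heisenberg n i a 0 u) <#\<^bsub>UT n\<^esub> block_unitri n {i}))"
  define L where "L = (\<lambda>(b, c). (i + 1, (g * heisenberg n i 0 b c) <#\<^bsub>UT n\<^esub> block_unitri n {i + 1}))"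
  have F: "F = U.std_flag g ?J" by (simp add: F_def U.std_flag_def)
  have stab: "U.stab J = block_unitri n J" for J
    unfolding U.stab_def by (rule block_unitri_Inter)
  have iI: "i \<in> ?I" "i + 1 \<in> ?I" and IJ: "?I - ?J = {i, i + 1}" using i by auto
  have El: "Elems (residue \<Gamma> F) =
      {(k, (g * d) <#\<^bsub>UT n\<^esub> block_unitri n {k}) | k d. k \<in> {i, i + 1} \<and> d \<in> block_unitri n ?J}"
    unfolding \<Gamma>_def F using U.Elems_residue[OF g Diff_subset, of "{i, i + 1}", unfolded IJ stab]
    by simp
  have hc: "heisenberg n i a b c \<in> carrier (UT n)" for a b c :: 'a
    unfolding carrier_UT by (rule block_unitri_UT[OF heisenberg_block_unitri])
  have ghc: "g * heisenberg n i a b c \<in> carrier (UT n)" for a b c :: 'a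
    using U.m_closed[OF g hc] by simp
  have assoc: "g * A * B = g * (A * B)" if "A \<in> carrier (UT n)" "B \<in> carrier (UT n)" for A B
    using U.m_assoc[OF g that] by simp
  have cancel: "A = B" if "g * A = g * B" "A \<in> carrier (UT n)" "B \<in> carrier (UT n)" for A B
    using U.Units_l_cancel[of g A B] g that by (simp add: U.Units_eq)
  have cancel_mult: "X * A = Y * B" if "g * (X * A) = g * (Y * B)"
    "X \<in> carrier (UT n)" "A \<in> carrier (UT n)" "Y \<in> carrier (UT n)" "B \<in> carrier (UT n)" for X A Y B
    using cancel[OF that(1)] U.m_closed[OF that(2,3)] U.m_closed[OF that(4,5)] by simp
  have inblock: "A \<in> carrier (UT n)" if "A \<in> block_unitri n J" for A :: "'a mat" and J
    unfolding carrier_UT using that by (rule block_unitri_UT)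
  have in_coset: "x \<in> (g * heisenberg n i a b c) <#\<^bsub>UT n\<^esub> block_unitri n {k} \<longleftrightarrow>
      (\<exists>A\<in>block_unitri n {k}. x = g * (heisenberg n i a b c * A))" for x a b c k
    using assoc[OF hc inblock] by (auto simp: l_coset_def)
  have mulC: "ent_a (A * B) = ent_a A + ent_a B" "ent_b (A * B) = ent_b A + ent_b B"
    "ent_c (A * B) = ent_c A + ent_a A * ent_b B + ent_c B"
    if "A \<in> carrier (UT n)" "B \<in> carrier (UT n)" for A B :: "'a mat"
    using entries_mult that unfolding carrier_UT by blast+
  have P_rep: "(i, (g * heisenberg n i a b c) <#\<^bsub>UT n\<^esub> block_unitri n {i}) = P (a, c - a * b)" for a b c
  proof -
    have "g * heisenberg n i a b c \<in> (g * heisenberg n i a 0 (c - a * b)) <#\<^bsub>UT n\<^esub> block_unitri n {i}"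
      unfolding in_coset
      by (rule bexI[OF _ heisenberg_vertex_stabilisers(1)[of b]]) (simp add: heisenberg_mult)
    then show ?thesis using U.coset_eq[OF iI(1) ghc] by (simp add: P_def)
  qed
  have L_rep: "(i + 1, (g * heisenberg n i a b c) <#\<^bsub>UT n\<^esub> block_unitri n {i + 1}) = L (b, c)" for a b c
  proof -
    have "g * heisenberg n i a b c \<in> (g * heisenberg n i 0 b c) <#\<^bsub>UT n\<^esub> block_unitri n {i + 1}"
      unfolding in_coset
      by (rule bexI[OF _ heisenberg_vertex_stabilisers(2)[of a]]) (simp add: heisenberg_mult)
    then show ?thesis using U.coset_eq[OF iI(2) ghc] by (simp add: L_def)
  qed
  have heisenberg_surj: "\<exists>a b c. d = heisenberg n i a b c" if "d \<in> block_unitri n ?J" for d :: "'a mat"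
  proof (intro exI)
    show "d = heisenberg n i (ent_a d) (ent_b d) (ent_c d)"
      by (rule block_unitri_rank2_eqI[OF that heisenberg_block_unitri]) simp_all
  qed
  have P_E: "\<exists>A\<in>block_unitri n {i}. x = g * (heisenberg n i a 0 u * A)" if "x \<in> snd (P (a, u))" for x a u
    using that in_coset by (simp add: P_def)
  have L_E: "\<exists>A\<in>block_unitri n {i + 1}. x = g * (heisenberg n i 0 b c * A)" if "x \<in> snd (L (b, c))" for x b c
    using that in_coset by (simp add: L_def)
  have inj_P: "(a, u) = (a', u')" if h: "x \<in> snd (P (a, u))" "x \<in> snd (P (a', u'))" for a u a' u' x
  proof -
    obtain A B where AB: "A \<in> block_unitri n {i}" "B \<in> block_unitri n {i}"
      "x = g * (heisenberg n i a 0 u * A)" "x = g * (heisenberg n i a' 0 u' * B)" using P_E[OF h(1)] P_E[OF h(2)] by blast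
    have c: "A \<in> carrier (UT n)" "B \<in> carrier (UT n)" using AB inblock by blast+
    have "heisenberg n i a 0 u * A = heisenberg n i a' 0 u' * B"
      by (rule cancel_mult) (use AB(3,4) c hc in simp_all)
    note eqs = arg_cong[OF this, of ent_a] arg_cong[OF this, of ent_b] arg_cong[OF this, of ent_c]
    then show ?thesis
      using entries_vertex_stabilisers(1,2)[OF AB(1)] entries_vertex_stabilisers(1,2)[OF AB(2)]
      by (simp add: mulC hc c)
  qed
  have inj_L: "(b, c) = (b', c')" if h: "x \<in> snd (L (b, c))" "x \<in> snd (L (b', c'))" for b c b' c' x
  proof -
    obtain A B where AB: "A \<in> block_unitri n {i + 1}" "B \<in> block_unitri n {i + 1}"
      "x = g * (heisenberg n i 0 b c * A)" "x = g * (heisenberg n i 0 b' c' * B)" using L_E[OF h(1)] L_E[OF h(2)] by blast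
    have c: "A \<in> carrier (UT n)" "B \<in> carrier (UT n)" using AB inblock by blast+
    have "heisenberg n i 0 b c * A = heisenberg n i 0 b' c' * B"
      by (rule cancel_mult) (use AB(3,4) c hc in simp_all)
    note eqs = arg_cong[OF this, of ent_a] arg_cong[OF this, of ent_b] arg_cong[OF this, of ent_c]
    then show ?thesis
      using entries_vertex_stabilisers(3,4)[OF AB(1)] entries_vertex_stabilisers(3,4)[OF AB(2)]
      by (simp add: mulC hc c)
  qed
  have PL: "snd (P (a, u)) \<inter> snd (L (b, c)) \<noteq> {} \<longleftrightarrow> c = u + a * b" for a u b c
  proof
    assume "snd (P (a, u)) \<inter> snd (L (b, c)) \<noteq> {}"
    then obtain x where x: "x \<in> snd (P (a, u))" "x \<in> snd (L (b, c))" by blast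
    obtain A B where AB: "A \<in> block_unitri n {i}" "B \<in> block_unitri n {i + 1}"
      "x = g * (heisenberg n i a 0 u * A)" "x = g * (heisenberg n i 0 b c * B)"
      using P_E[OF x(1)] L_E[OF x(2)] by blast
    have cc: "A \<in> carrier (UT n)" "B \<in> carrier (UT n)" using AB inblock by blast+
    have "heisenberg n i a 0 u * A = heisenberg n i 0 b c * B"
      by (rule cancel_mult) (use AB(3,4) cc hc in simp_all)
    note eqs = arg_cong[OF this, of ent_a] arg_cong[OF this, of ent_b] arg_cong[OF this, of ent_c]
    then show "c = u + a * b"
      using entries_vertex_stabilisers(1,2)[OF AB(1)] entries_vertex_stabilisers(3,4)[OF AB(2)]
      by (simp add: mulC hc cc)
  next
    assume c: "c = u + a * b"
    have "snd (P (a, c - a * b)) = (g * heisenberg n i a b c) <#\<^bsub>UT n\<^esub> block_unitri n {i}"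
      "snd (L (b, c)) = (g * heisenberg n i a b c) <#\<^bsub>UT n\<^esub> block_unitri n {i + 1}"
      unfolding P_rep[symmetric] L_rep[of a, symmetric] by simp_all
    moreover have "c - a * b = u" using c by simp
    ultimately have "g * heisenberg n i a b c \<in> snd (P (a, u))" "g * heisenberg n i a b c \<in> snd (L (b, c))"
      using U.rep_in_coset[OF iI(1) ghc] U.rep_in_coset[OF iI(2) ghc] by simp_all
    then show "snd (P (a, u)) \<inter> snd (L (b, c)) \<noteq> {}" by blast
  qed
  have ne: "snd (P x) \<noteq> {}" "snd (L x) \<noteq> {}" for x
    using U.rep_in_coset[OF iI(1) ghc] U.rep_in_coset[OF iI(2) ghc]
    by (cases x; force simp: P_def L_def)+
  have PP: "snd (P x) \<inter> snd (P y) \<noteq> {} \<longleftrightarrow> x = y" for x y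
    using inj_P ne by (cases x; cases y) blast
  have LL: "snd (L x) \<inter> snd (L y) \<noteq> {} \<longleftrightarrow> x = y" for x y
    using inj_L ne by (cases x; cases y) blast
  have "affine_net (residue \<Gamma> F) i (i + 1) P L"
  proof
    show "Elems (residue \<Gamma> F) = range P \<union> range L"
    proof
      show "Elems (residue \<Gamma> F) \<subseteq> range P \<union> range L"
        unfolding El using heisenberg_surj P_rep L_rep by blast
      have "P x \<in> Elems (residue \<Gamma> F)" "L x \<in> Elems (residue \<Gamma> F)" for x
        unfolding El using heisenberg_block_unitri by (cases x; force simp: P_def L_def)+
      then show "range P \<union> range L \<subseteq> Elems (residue \<Gamma> F)" by blast
    qed
    show "inj P" "inj L" using PP LL ne by (metis Int_absorb injI)+
    show "type_of (residue \<Gamma> F) (P x) = i" "type_of (residue \<Gamma> F) (L x) = i + 1" for x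
      unfolding \<Gamma>_def U.residue_simps by (simp_all add: P_def L_def split_beta)
    show "incident (residue \<Gamma> F) (P (a, u)) (L (b, c)) \<longleftrightarrow> c = u + a * b"
      "incident (residue \<Gamma> F) (L (b, c)) (P (a, u)) \<longleftrightarrow> c = u + a * b" for a u b c
      unfolding \<Gamma>_def U.residue_simps using PL by (simp_all only: Int_commute)
    show "incident (residue \<Gamma> F) (P x) (P y) \<longleftrightarrow> x = y"
      "incident (residue \<Gamma> F) (L x) (L y) \<longleftrightarrow> x = y" for x y
      unfolding \<Gamma>_def U.residue_simps by (rule PP, rule LL)
  qed simp
  then show ?thesis unfolding P_def L_def .
qed

end

section \<open>The coset geometry of the unitriangular group\<close>

theorem theorem4p4:
  fixes n p m q :: nat
    and T :: "'a::{field,finite} set"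
    and U :: "'a mat monoid"
    and I :: "nat set"
    and H :: "nat \<Rightarrow> 'a mat set"
    and \<Gamma> :: "(nat \<times> 'a mat set, nat) incidence_structure"
  assumes n: "n \<ge> 2"
    and p: "prime p" "CARD('p::prime_card) = p"
    and q: "m \<ge> 1" "q = p ^ m" "CARD('a) = q"
    and T: "Fp_basis TYPE('p) T"
    and U: "U = UT n"
    and I: "I = {1..n-1}"
    and H: "\<And>i. i \<in> I \<Longrightarrow> H i = generate U {e_mat n j t | j t. t \<in> T \<and> j \<in> I - {i}}"
    and \<Gamma>: "\<Gamma> = coset_incidence_system U I H"
  shows "incidence_geometry \<Gamma> \<and>
    flag_transitive U (coset_action U) \<Gamma> \<and>
    residually_connected \<Gamma> \<and>
    (q \<noteq> 2 \<longrightarrow> thick \<Gamma>) \<and>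
    (q = 2 \<longrightarrow> thin \<Gamma>) \<and>
    (\<forall>i\<in>I. vertex_order \<Gamma> i (q - 1)) \<and>
    (\<forall>i\<in>I. \<forall>j\<in>I. \<bar>int i - int j\<bar> > 1 \<longrightarrow> \<not> joined \<Gamma> i j) \<and>
    (\<forall>i\<in>{1..n-2}. joined \<Gamma> i (i + 1)) \<and>
    (q \<noteq> 2 \<longrightarrow> (\<forall>i\<in>{1..n-2}. edge_label \<Gamma> i (i + 1) (4, 3, 4))) \<and>
    (q = 2 \<longrightarrow> (\<forall>i\<in>{1..n-2}. edge_label \<Gamma> i (i + 1) (4, 4, 4) \<and>
       (\<forall>F. flag_of_type \<Gamma> (I - {i, i + 1}) F \<longrightarrow>
          generalized_polygon (residue \<Gamma> F) i (i + 1) 4)))"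
proof -
  have char: "CHAR('a) = CARD('p)"
    using CHAR_eq_of_card[where 'a = 'a, of p m] p q by simp
  have HB: "H i = block_unitri n {i}" if "i \<in> I" for i
    unfolding H[OF that] U I by (rule generate_eq_block_unitri[OF char T])
  interpret G: linear_coset_geometry "UT n :: 'a mat monoid" "{1..n-1}" "\<lambda>i. block_unitri n {i}"
    by (rule linear_coset_geometry_UT)
  have \<Gamma>G: "\<Gamma> = G.\<Gamma>"
  proof -
    have "{(i, g <#\<^bsub>U\<^esub> H i) | i g. i \<in> I \<and> g \<in> carrier U} =
        {(i, g <#\<^bsub>U\<^esub> block_unitri n {i}) | i g. i \<in> I \<and> g \<in> carrier U}"
    proof -
      have "x = (i, g <#\<^bsub>U\<^esub> H i) \<and> i \<in> I \<and> g \<in> carrier U \<longleftrightarrow>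
          x = (i, g <#\<^bsub>U\<^esub> block_unitri n {i}) \<and> i \<in> I \<and> g \<in> carrier U" for x i g
        using HB by auto
      then show ?thesis by simp
    qed
    then show ?thesis unfolding \<Gamma> coset_incidence_system_def by (simp add: U I)
  qed
  have stab: "G.stab J = block_unitri n J" for J
    unfolding G.stab_def by (rule block_unitri_Inter)
  have q2: "q \<ge> 2"
  proof -
    have "2 ^ 1 \<le> p ^ 1" using prime_ge_2_nat[OF p(1)] by simp
    also have "\<dots> \<le> p ^ m" using q(1) prime_gt_0_nat[OF p(1)] by (intro power_increasing) auto
    finally show ?thesis by (simp add: q(2))
  qed
  have order: "card (Elems (residue \<Gamma> F)) = q"
    if "i \<in> I" "flag_of_type \<Gamma> (I - {i}) F" for i F
  proof -
    have i: "1 \<le> i" "i < n" "i \<in> {1..n-1}" using that(1) by (auto simp: I)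
    show ?thesis
      using G.card_rank_one_residue[OF i(3)] that(2) card_block_unitri_root[OF i(1,2), where 'a = 'a]
      unfolding \<Gamma>G I stab by (simp add: q(3))
  qed
  have rank_one: "card (Elems (residue \<Gamma> F)) = q" if h: "flag \<Gamma> F" "rank (residue \<Gamma> F) = 1" for F
  proof -
    obtain i where "i \<in> {1..n-1}" "flag_of_type \<Gamma> ({1..n-1} - {i}) F"
      using h unfolding \<Gamma>G by (rule G.rank_one_residue_type)
    then show ?thesis using order unfolding I by blast
  qed
  have types: "Types \<Gamma> = I" unfolding \<Gamma>G I by (rule G.Gamma_simps)
  have net: "\<exists>P L :: 'a \<times> 'a \<Rightarrow> _. affine_net (residue \<Gamma> F) i (i + 1) P L"
    if i: "i \<in> {1..n-2}" and F: "flag_of_type \<Gamma> (I - {i, i + 1}) F" for i F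
  proof -
    have fl: "flag G.\<Gamma> F" and ty: "fst ` F = {1..n-1} - {i, i + 1}"
      using F unfolding flag_of_type_def \<Gamma>G I G.Gamma_simps by blast+
    obtain g where g: "g \<in> carrier (UT n)" "F = G.std_flag g ({1..n-1} - {i, i + 1})"
      using G.flag_std[OF fl] unfolding ty by blast
    have "1 \<le> i" "i + 1 < n" using i by auto
    from affine_net_residue[OF this g(1)] show ?thesis
      unfolding \<Gamma>G g(2) G.std_flag_def by blast
  qed
  have label: "rank2_parameters (residue \<Gamma> F) i (i + 1) (4, if q = 2 then 4 else 3, 4)"
    if "i \<in> {1..n-2}" "flag_of_type \<Gamma> (I - {i, i + 1}) F" for i F
  proof -
    obtain P L :: "'a \<times> 'a \<Rightarrow> _" where "affine_net (residue \<Gamma> F) i (i + 1) P L"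
      using net[OF \<open>i \<in> {1..n-2}\<close> \<open>flag_of_type \<Gamma> (I - {i, i + 1}) F\<close>] by blast
    from affine_net.rank2_parameters[OF this] show ?thesis using q2 by (simp add: q(3))
  qed
  have not_joined: "\<not> joined \<Gamma> i j" if "i \<in> I" "j \<in> I" "\<bar>int i - int j\<bar> > 1" for i j
  proof (cases "i < j")
    case True
    then show ?thesis
      using G.not_joined(1)[of i j "i + 1"] that unfolding \<Gamma>G I by auto
  next
    case False
    then show ?thesis
      using G.not_joined(2)[of j i "j + 1"] that unfolding \<Gamma>G I by auto
  qed
  have joined: "joined \<Gamma> i (i + 1)" if i: "i \<in> {1..n-2}" for i
  proof -
    let ?F = "G.std_flag (1\<^sub>m n) ({1..n-1} - {i, i + 1})"
    have F: "flag_of_type \<Gamma> (I - {i, i + 1}) ?F"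
      unfolding flag_of_type_def \<Gamma>G I G.Gamma_simps
      by (rule conjI[OF G.std_flag_flag[OF G.one_closed Diff_subset, unfolded UT_simps]
            G.std_flag_type])
    from net[OF i F] obtain P L :: "'a \<times> 'a \<Rightarrow> _"
      where "affine_net (residue \<Gamma> ?F) i (i + 1) P L" by blast
    then interpret N: affine_net "residue \<Gamma> ?F" i "i + 1" P L .
    have "\<not> incident (residue \<Gamma> ?F) (P (0, 0)) (L (0, 1))" unfolding N.inc_PL by simp
    then have "\<not> generalized_digon (residue \<Gamma> ?F) i (i + 1)"
      unfolding generalized_digon_def using N.type_P N.type_L N.Elems_P N.Elems_L by blast
    moreover have "i \<noteq> i + 1" by simp
    ultimately show ?thesis unfolding joined_def types using F by blast
  qed
  have "thick \<Gamma>" if "q \<noteq> 2"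
    unfolding thick_def using rank_one q2 that by auto
  moreover have "thin \<Gamma>" if "q = 2"
    unfolding thin_def using rank_one that by auto
  moreover have "vertex_order \<Gamma> i (q - 1)" if "i \<in> I" for i
    unfolding vertex_order_def types using order[OF that] q2 by simp
  moreover have "edge_label \<Gamma> i (i + 1) (4, 3, 4)" if "q \<noteq> 2" "i \<in> {1..n-2}" for i
    unfolding edge_label_def types using label[OF that(2)] that(1) by simp
  moreover have "edge_label \<Gamma> i (i + 1) (4, 4, 4)" if "q = 2" "i \<in> {1..n-2}" for i
    unfolding edge_label_def types using label[OF that(2)] that(1) by simp
  moreover have "incidence_geometry \<Gamma>" "flag_transitive U (coset_action U) \<Gamma>" "residually_connected \<Gamma>"
    unfolding \<Gamma>G U by (rule G.incidence_geometry G.flag_transitive G.residually_connected)+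
  moreover have "generalized_polygon (residue \<Gamma> F) i (i + 1) 4"
    if "q = 2" "i \<in> {1..n-2}" "flag_of_type \<Gamma> (I - {i, i + 1}) F" for i F
    using label[OF that(2,3)] that(1) by (simp add: generalized_polygon_def)
  ultimately show ?thesis using not_joined joined by blast
qed

end
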